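(* Let $\{\boldsymbol Z_n\}_{n\ge 0}$ be a non-singular multitype Galton--Watson branching process with countable typeset $\mathcal X$, and let $\boldsymbol s\in S$. (1) If $q_x(\{x\})=q_x$ for all $x\in\mathcal X$ then, for every $x\in\mathcal X$, either $s_x=1$ or $s_x=q_x(\{x\})$. In this case, any fixed point is an extinction probability vector, that is, $\mathrm{Ext}=S$. (2) If $\{\boldsymbol Z_n\}_{n\ge0}$ is irreducible and $\boldsymbol s\ne\boldsymbol 1$, then $\boldsymbol s\le\tilde{\boldsymbol q}$. In particular, if the process is irreducible and $\tilde{\boldsymbol q}=\boldsymbol q$, then $S=\{\boldsymbol q,\boldsymbol 1\}$.
   Context: A multitype Galton--Watson branching process (MGWBP) $\{\boldsymbol Z_n\}_{n\ge0}$ with countable (finite or countably infinite) typeset $\mathcal X$: $\boldsymbol Z_n=(Z_{n,x})_{x\in\mathcal X}$, where $Z_{n,x}$ is the number of type-$x$ individuals in generation $n$. Each individual lives for one generation and at death, independently of all others, gives birth to a finite random number of offspring; a type-$x$ individual has $j_y$ children of type $y$ for all $y\in\mathcal X$ with probability $p_{x\boldsymbol j}$, $\boldsymbol j=(j_y)_{y\in\mathcal X}$, $|\boldsymbol j|:=\sum_y j_y<\infty$. The progeny generating function is $\boldsymbol G(\boldsymbol s)=(G_x(\boldsymbol s))_{x\in\mathcal X}$, $G_x(\boldsymbol s)=\sum_{\boldsymbol j:|\boldsymbol j|<\infty}p_{x\boldsymbol j}\prod_{y}s_y^{j_y}$, $\boldsymbol s\in[0,1]^{\mathcal X}$, and $S=\{\boldsymbol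 s\in[0,1]^{\mathcal X}:\boldsymbol s=\boldsymbol G(\boldsymbol s)\}$ is its set of fixed points. $\mathbb P_x$ denotes the law of the process started from a single type-$x$ individual. For $A\subseteq\mathcal X$, $\mathcal E(A)$ is the event $\lim_{n\to\infty}\sum_{x\in A}Z_{n,x}=0$ (extinction in $A$); $\boldsymbol q(A)=(q_x(A))_{x\in\mathcal X}$ with $q_x(A)=\mathbb P_x(\mathcal E(A))$; $\boldsymbol q=(q_x)_{x\in\mathcal X}=\boldsymbol q(\mathcal X)$; $\mathrm{Ext}=\{\boldsymbol q(A):A\subseteq\mathcal X\}$ (with $\boldsymbol q(\emptyset)=\boldsymbol 1$); $\tilde q_x=\mathbb P_x\big(\bigcap_{A:|A|<\infty}\mathcal E(A)\big)$, $\tilde{\boldsymbol q}=(\tilde q_x)_{x\in\mathcal X}$. Vector inequalities $\le$ are componentwise; $\boldsymbol 1$ is the all-ones vector. Let $m_{xy}=\mathbb E_x[Z_{1,y}]$ and consider the directed graph on $\mathcal X$ with an edge $(x,y)$ iff $m_{xy}>0$. Write $x\to y$ if there is a path (possibly of length zero) from $x$ to $y$, and $x\leftrightarrow y$ if $x\to y$ and $y\to x$. The process is irreducible if $x\leftrightarrow y$ for all $x,y\in\mathcal X$. It is non-singular if for every $x\in\mathcal X$ there exists $y\leftrightarrow x$ such that $\mathbb P_y\big(\sum_{w\leftrightarrow y}Z_{1,w}=1\big)<1$. *)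

theory Defs
  imports "HOL-Probability.Probability" "HOL-Library.Multiset"
begin

(* The type 'x is the typeset.  A vector (j_y) of nonnegative integers with finite total
   is a finite multiset over 'x, so the offspring distributions (p_xj) of the types x form
   a family p of probability mass functions on 'x multiset. *)

definition progeny_gf :: "('x \<Rightarrow> 'x multiset pmf) \<Rightarrow> ('x \<Rightarrow> real) \<Rightarrow> 'x \<Rightarrow> real" where
  "progeny_gf p s x = (\<Sum>\<^sub>\<infinity>j. pmf (p x) j * (\<Prod>y\<in>set_mset j. s y ^ count j y))"

definition fixed_points :: "('x \<Rightarrow> 'x multiset pmf) \<Rightarrow> ('x \<Rightarrow> real) set" where
  "fixed_points p = {s. (\<forall>x. 0 \<le> s x \<and> s x \<le> 1) \<and> s = progeny_gf p s}"

(* The coordinate (n, y, i) of a sample point is the offspring of the i-th individual of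
   type y in generation n.  These offspring are independent, with law p y. *)

definition gw_space ::
    "('x \<Rightarrow> 'x multiset pmf) \<Rightarrow> (nat \<times> 'x \<times> nat \<Rightarrow> 'x multiset) measure" where
  "gw_space p = (\<Pi>\<^sub>M (n, y, i)\<in>UNIV. measure_pmf (p y))"

(* The population started from one individual of type x.  The law written P_x on paper is
   the law of this process under gw_space p. *)

primrec generation ::
    "'x \<Rightarrow> nat \<Rightarrow> (nat \<times> 'x \<times> nat \<Rightarrow> 'x multiset) \<Rightarrow> 'x multiset" where
  "generation x 0 \<omega> = {#x#}"
| "generation x (Suc n) \<omega> =
    (\<Sum>y\<in>set_mset (generation x n \<omega>). \<Sum>i<count (generation x n \<omega>) y. \<omega> (n, y, i))"

definition extinct_in ::
    "'x \<Rightarrow> 'x set \<Rightarrow> (nat \<times> 'x \<times> nat \<Rightarrow> 'x multiset) \<Rightarrow> bool" where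
  "extinct_in x A \<omega> \<longleftrightarrow>
    (\<lambda>n. real (size (filter_mset (\<lambda>y. y \<in> A) (generation x n \<omega>)))) \<longlonglongrightarrow> 0"

definition ext_prob :: "('x \<Rightarrow> 'x multiset pmf) \<Rightarrow> 'x set \<Rightarrow> 'x \<Rightarrow> real" where
  "ext_prob p A x = \<P>(\<omega> in gw_space p. extinct_in x A \<omega>)"

definition global_ext_prob :: "('x \<Rightarrow> 'x multiset pmf) \<Rightarrow> 'x \<Rightarrow> real" where
  "global_ext_prob p = ext_prob p UNIV"

definition ext_vectors :: "('x \<Rightarrow> 'x multiset pmf) \<Rightarrow> ('x \<Rightarrow> real) set" where
  "ext_vectors p = range (ext_prob p)"

definition partial_ext_prob :: "('x \<Rightarrow> 'x multiset pmf) \<Rightarrow> 'x \<Rightarrow> real" where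
  "partial_ext_prob p x = \<P>(\<omega> in gw_space p. \<forall>A. finite A \<longrightarrow> extinct_in x A \<omega>)"

definition mean_offspring :: "('x \<Rightarrow> 'x multiset pmf) \<Rightarrow> 'x \<Rightarrow> 'x \<Rightarrow> ennreal" where
  "mean_offspring p x y = (\<integral>\<^sup>+ \<omega>. of_nat (count (generation x 1 \<omega>) y) \<partial>gw_space p)"

definition leads_to :: "('x \<Rightarrow> 'x multiset pmf) \<Rightarrow> 'x \<Rightarrow> 'x \<Rightarrow> bool" where
  "leads_to p = (\<lambda>x y. mean_offspring p x y > 0)\<^sup>*\<^sup>*"

definition communicates :: "('x \<Rightarrow> 'x multiset pmf) \<Rightarrow> 'x \<Rightarrow> 'x \<Rightarrow> bool" where
  "communicates p x y \<longleftrightarrow> leads_to p x y \<and> leads_to p y x"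

definition irreducible_process :: "('x \<Rightarrow> 'x multiset pmf) \<Rightarrow> bool" where
  "irreducible_process p \<longleftrightarrow> (\<forall>x y. communicates p x y)"

definition nonsingular_process :: "('x \<Rightarrow> 'x multiset pmf) \<Rightarrow> bool" where
  "nonsingular_process p \<longleftrightarrow>
    (\<forall>x. \<exists>y. communicates p y x \<and>
      \<P>(\<omega> in gw_space p. size (filter_mset (\<lambda>w. communicates p w y) (generation y 1 \<omega>)) = 1) < 1)"

end

theory Submission
  imports Defs
begin

text \<open>
  Write G for the progeny generating function and F for the product of the values of a fixed
  point s over the current population; F has constant expectation, and the expectation of
  F squared increases to a fixed point t with t \<ge> s^2.  If t is at least
  (1 + \<delta>) s^2 on a set A of types, stop every line of descent at its first visit to A after
  generation n: the stopped product T of t satisfies T - F^2 \<ge> \<delta> F^2 as soon as A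
  is hit, while the expectation of T - F^2 tends to 0.  So F carries almost no mass on the
  event that A is visited late, and s is bounded by the probability of extinction in A.

  If instead t = s^2 at some x with 0 < s x < 1, then F is deterministic for the process started
  from x.  Hence s is constant on the communication class of x, every member of the class has at
  most one child in the class, and by non-singularity some member may have none.  In the irreducible
  case that member can die childless, which would force s = 1.  In general the class line dies out
  with positive probability although global extinction has probability 0, which contradicts the
  hypothesis of part (1).
\<close>

section \<open>Progeny generating functions\<close>

definition unit_vector :: "('x \<Rightarrow> real) \<Rightarrow> bool" where
  "unit_vector f \<longleftrightarrow> (\<forall>x. 0 \<le> f x \<and> f x \<le> 1)"

abbreviation mset_prod :: "('x \<Rightarrow> real) \<Rightarrow> 'x multiset \<Rightarrow> real" where
  "mset_prod f j \<equiv> (\<Prod>y\<in>#j. f y)"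

lemma unit_vectorD: "unit_vector f \<Longrightarrow> 0 \<le> f x" "unit_vector f \<Longrightarrow> f x \<le> 1"
  by (auto simp: unit_vector_def)

lemma mset_prod_nonneg: "unit_vector f \<Longrightarrow> 0 \<le> mset_prod f j"
  by (induction j) (auto simp: unit_vector_def)

lemma mset_prod_le_1: "unit_vector f \<Longrightarrow> mset_prod f j \<le> 1"
  by (induction j) (auto simp: unit_vectorD mset_prod_nonneg intro!: mult_le_one)

lemma mset_prod_mono:
  assumes "\<And>y. y \<in># j \<Longrightarrow> 0 \<le> f y" "\<And>y. y \<in># j \<Longrightarrow> f y \<le> g y"
  shows "0 \<le> mset_prod f j \<and> mset_prod f j \<le> mset_prod g j"
  using assms
proof (induction j)
  case (add x j)
  then have "0 \<le> mset_prod f j \<and> mset_prod f j \<le> mset_prod g j" by simp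
  with add.prems show ?case
    by (simp add: mult_mono' mult_nonneg_nonneg)
qed simp

lemma mset_prod_le_member:
  assumes "unit_vector f" "y \<in># j"
  shows "mset_prod f j \<le> f y"
proof -
  obtain k where "j = add_mset y k" using assms(2) by (metis multi_member_split)
  then show ?thesis
    using mset_prod_le_1[OF assms(1), of k] unit_vectorD[OF assms(1), of y] by (simp add: mult_left_le)
qed

lemma mset_prod_square: "mset_prod (\<lambda>y. (f y)\<^sup>2) j = (mset_prod f j)\<^sup>2"
  by (induction j) (auto simp: power_mult_distrib)

lemma unit_vector_square: "unit_vector f \<Longrightarrow> unit_vector (\<lambda>y. (f y)\<^sup>2)"
  by (auto simp: unit_vector_def power_le_one)

text \<open>All factors compare in the same direction, so a strict gap at one of them cannot be made
  up by the others. Positivity of the product excludes the case where a zero factor hides the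
  gap.\<close>

lemma mset_prod_eq_imp_eq:
  assumes "\<And>y. y \<in># j \<Longrightarrow> 0 \<le> f y \<and> f y \<le> g y" and "mset_prod f j = mset_prod g j"
    and "0 < mset_prod f j" and "y \<in># j"
  shows "f y = g y"
proof -
  obtain k where k: "j = add_mset y k" using assms(4) by (metis multi_member_split)
  have le: "0 \<le> mset_prod f k \<and> mset_prod f k \<le> mset_prod g k"
    using assms(1) by (intro mset_prod_mono) (auto simp: k)
  have "mset_prod f k > 0" using assms(3) le by (auto simp: k zero_less_mult_iff)
  moreover have "g y * mset_prod f k \<le> g y * mset_prod g k"
    using assms(1)[OF assms(4)] le by (intro mult_left_mono) auto
  then have "g y * mset_prod f k \<le> f y * mset_prod f k"
    using assms(2) by (simp add: k)
  ultimately show ?thesis using assms(1)[OF assms(4)] by (simp add: antisym)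
qed

lemma integrable_mset_prod:
  "unit_vector f \<Longrightarrow> integrable (measure_pmf q) (mset_prod f)"
  by (rule measure_pmf.integrable_const_bound[where B = 1])
     (auto simp: mset_prod_nonneg mset_prod_le_1)

text \<open>Turns the infinite sum over offspring multisets into an integral, so that dominated
  convergence and the variance formula apply. Absolute summability comes from the products lying in
  [0,1].\<close>

lemma progeny_gf_eq_expectation:
  assumes "unit_vector f"
  shows "progeny_gf p f x = measure_pmf.expectation (p x) (mset_prod f)"
proof -
  have "Infinite_Set_Sum.abs_summable_on (\<lambda>j. pmf (p x) j * mset_prod f j) UNIV"
    using integrable_mset_prod[OF assms, of "p x"]
    unfolding measure_pmf_eq_density Infinite_Set_Sum.abs_summable_on_def
    by (subst (asm) integrable_density) auto
  then have "infsetsum (\<lambda>j. pmf (p x) j * mset_prod f j) UNIV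
      = (\<Sum>\<^sub>\<infinity>j. pmf (p x) j * mset_prod f j)"
    by (intro infsetsum_infsum) (simp add: abs_summable_equivalent)
  then show ?thesis
    by (simp add: progeny_gf_def pmf_expectation_eq_infsetsum image_prod_mset_multiplicity)
qed

lemma unit_vector_progeny_gf:
  assumes "unit_vector f"
  shows "unit_vector (progeny_gf p f)"
  unfolding unit_vector_def progeny_gf_eq_expectation[OF assms]
  by (auto intro!: integral_nonneg_AE measure_pmf.integral_le_const integrable_mset_prod
      simp: mset_prod_nonneg mset_prod_le_1 assms)

lemma progeny_gf_mono:
  assumes "unit_vector f" "unit_vector g" "\<And>y. f y \<le> g y"
  shows "progeny_gf p f x \<le> progeny_gf p g x"
  unfolding progeny_gf_eq_expectation[OF assms(1)] progeny_gf_eq_expectation[OF assms(2)]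
  using assms by (intro integral_mono integrable_mset_prod)
    (auto intro: mset_prod_mono[THEN conjunct2] simp: unit_vectorD)

lemma tendsto_mset_prod:
  "(\<And>y. (\<lambda>n. f n y) \<longlonglongrightarrow> g y) \<Longrightarrow> (\<lambda>n. mset_prod (f n) j) \<longlonglongrightarrow> mset_prod g j"
  by (induction j) (auto intro: tendsto_mult)

lemma tendsto_progeny_gf:
  assumes "\<And>n. unit_vector (f n)" "unit_vector g" "\<And>y. (\<lambda>n. f n y) \<longlonglongrightarrow> g y"
  shows "(\<lambda>n. progeny_gf p (f n) x) \<longlonglongrightarrow> progeny_gf p g x"
  unfolding progeny_gf_eq_expectation[OF assms(1)] progeny_gf_eq_expectation[OF assms(2)]
  by (rule integral_dominated_convergence[where w = "\<lambda>_. 1"])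
     (auto intro!: tendsto_mset_prod assms simp: mset_prod_nonneg mset_prod_le_1 assms)

lemma unit_vector_limit:
  assumes "\<And>n. unit_vector (f n)" "\<And>y. (\<lambda>n. f n y) \<longlonglongrightarrow> g y"
  shows "unit_vector g"
  unfolding unit_vector_def
  using LIMSEQ_le_const[OF assms(2)] LIMSEQ_le_const2[OF assms(2)] unit_vectorD[OF assms(1)] by blast

lemma integral_pmf_eq_0_imp:
  fixes h :: "'a \<Rightarrow> real"
  assumes "integrable (measure_pmf q) h" "\<And>j. j \<in> set_pmf q \<Longrightarrow> 0 \<le> h j"
    and "measure_pmf.expectation q h = 0" and "j \<in> set_pmf q"
  shows "h j = 0"
  using assms integral_nonneg_eq_0_iff_AE[of q h] by (auto simp: AE_measure_pmf_iff)

text \<open>This is the variance formula for the product of \<open>f\<close> over the offspring,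
  since squaring commutes with products. Equality in \<open>progeny_gf_square_ge\<close> thus means
  that the product is almost surely constant.\<close>

lemma progeny_gf_square_diff:
  assumes "unit_vector f"
  shows "progeny_gf p (\<lambda>y. (f y)\<^sup>2) x - (progeny_gf p f x)\<^sup>2
    = measure_pmf.expectation (p x) (\<lambda>j. (mset_prod f j - progeny_gf p f x)\<^sup>2)"
proof -
  have "measure_pmf.variance (p x) (mset_prod f)
      = measure_pmf.expectation (p x) (\<lambda>j. (mset_prod f j)\<^sup>2)
        - (measure_pmf.expectation (p x) (mset_prod f))\<^sup>2"
    using integrable_mset_prod[OF unit_vector_square[OF assms], of "p x"]
    by (intro measure_pmf.variance_eq integrable_mset_prod assms) (simp add: mset_prod_square)
  then show ?thesis
    by (simp add: progeny_gf_eq_expectation assms unit_vector_square mset_prod_square)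
qed

lemma progeny_gf_square_ge:
  assumes "unit_vector f"
  shows "(progeny_gf p f x)\<^sup>2 \<le> progeny_gf p (\<lambda>y. (f y)\<^sup>2) x"
proof -
  have "0 \<le> progeny_gf p (\<lambda>y. (f y)\<^sup>2) x - (progeny_gf p f x)\<^sup>2"
    unfolding progeny_gf_square_diff[OF assms] by simp
  then show ?thesis by simp
qed

lemma progeny_gf_eq_1_iff:
  assumes "unit_vector f"
  shows "progeny_gf p f x = 1 \<longleftrightarrow> (\<forall>j\<in>set_pmf (p x). mset_prod f j = 1)"
proof
  assume "progeny_gf p f x = 1"
  then have E: "measure_pmf.expectation (p x) (\<lambda>j. 1 - mset_prod f j) = 0"
    using integrable_mset_prod[OF assms, of "p x"]
    by (simp add: progeny_gf_eq_expectation[OF assms])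
  have I: "integrable (measure_pmf (p x)) (\<lambda>j. 1 - mset_prod f j)"
    using integrable_mset_prod[OF assms, of "p x"] by simp
  show "\<forall>j\<in>set_pmf (p x). mset_prod f j = 1"
  proof
    fix j assume "j \<in> set_pmf (p x)"
    from integral_pmf_eq_0_imp[OF I _ E this] show "mset_prod f j = 1"
      using mset_prod_le_1[OF assms] by simp
  qed
next
  assume *: "\<forall>j\<in>set_pmf (p x). mset_prod f j = 1"
  have "measure_pmf.expectation (p x) (mset_prod f) = measure_pmf.expectation (p x) (\<lambda>_. 1)"
    using * by (intro integral_cong_AE) (auto simp: AE_measure_pmf_iff)
  then show "progeny_gf p f x = 1"
    by (simp add: progeny_gf_eq_expectation assms)
qed

lemma unit_vector_iterate:
  "unit_vector f \<Longrightarrow> unit_vector ((progeny_gf p ^^ n) f)"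
  by (induction n) (auto intro: unit_vector_progeny_gf)

lemma iterate_mono:
  assumes "unit_vector f" "unit_vector g" "\<And>y. f y \<le> g y"
  shows "(progeny_gf p ^^ n) f x \<le> (progeny_gf p ^^ n) g x"
  using assms
  by (induction n arbitrary: x) (auto intro: progeny_gf_mono unit_vector_iterate)

lemma fixed_points_iff: "s \<in> fixed_points p \<longleftrightarrow> unit_vector s \<and> progeny_gf p s = s"
  by (auto simp: fixed_points_def unit_vector_def)

lemma iterate_fixed: "progeny_gf p s = s \<Longrightarrow> (progeny_gf p ^^ n) s = s"
  by (induction n) auto

text \<open>An individual of a type in \<open>A\<close> is replaced by itself, so a line of descent
  stops at its first visit to \<open>A\<close>. Stopping along lines thereby becomes iteration of
  another generating function, which keeps every fixed point of \<open>p\<close>.\<close>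

definition frozen :: "('x \<Rightarrow> 'x multiset pmf) \<Rightarrow> 'x set \<Rightarrow> 'x \<Rightarrow> 'x multiset pmf" where
  "frozen p A y = (if y \<in> A then return_pmf {#y#} else p y)"

lemma progeny_gf_frozen:
  assumes "unit_vector f"
  shows "progeny_gf (frozen p A) f y = (if y \<in> A then f y else progeny_gf p f y)"
  by (simp add: progeny_gf_eq_expectation assms frozen_def)

section \<open>Random multisets realizing compositions of generating functions\<close>

lemma expectation_bind_pmf:
  fixes f :: "'b \<Rightarrow> real"
  assumes "\<And>b. 0 \<le> f b" "\<And>b. f b \<le> 1"
  shows "measure_pmf.expectation (bind_pmf q N) f
    = measure_pmf.expectation q (\<lambda>a. measure_pmf.expectation (N a) f)"
proof -
  have int: "integrable (measure_pmf r) f" for r :: "'b pmf"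
    using assms by (intro measure_pmf.integrable_const_bound[where B = 1]) auto
  have bounds: "0 \<le> measure_pmf.expectation r f" "measure_pmf.expectation r f \<le> 1" for r :: "'b pmf"
    using assms int by (auto intro!: integral_nonneg_AE measure_pmf.integral_le_const)
  have int': "integrable (measure_pmf q) (\<lambda>a. measure_pmf.expectation (N a) f)"
    using bounds by (intro measure_pmf.integrable_const_bound[where B = 1]) auto
  have "ennreal (measure_pmf.expectation (bind_pmf q N) f)
      = ennreal (measure_pmf.expectation q (\<lambda>a. measure_pmf.expectation (N a) f))"
    using assms bounds by (simp add: nn_integral_eq_integral[symmetric] int int')
  then show ?thesis
    using bounds by (simp add: integral_nonneg_AE)
qed

text \<open>The law is that of a sum of independent draws, one from \<open>R y\<close> for each
  member \<open>y\<close> of \<open>j\<close>; adding one member is a convolution, and product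
  functionals are multiplicative under it.\<close>

lemma indep_sum_pmf_exists:
  assumes "\<And>y. \<forall>f. unit_vector f \<longrightarrow> measure_pmf.expectation (R y) (mset_prod f) = H f y"
  shows "\<exists>Q. \<forall>f. unit_vector f \<longrightarrow> measure_pmf.expectation Q (mset_prod f) = mset_prod (H f) j"
proof (induction j)
  case empty
  show ?case by (intro exI[of _ "return_pmf {#}"]) simp
next
  case (add y j)
  then obtain Q where Q: "\<And>f. unit_vector f \<Longrightarrow>
      measure_pmf.expectation Q (mset_prod f) = mset_prod (H f) j" by blast
  define T where "T = bind_pmf (R y) (\<lambda>a. map_pmf (\<lambda>b. a + b) Q)"
  have "measure_pmf.expectation T (mset_prod f) = mset_prod (H f) (add_mset y j)"
    if f: "unit_vector f" for f
  proof -
    have "measure_pmf.expectation T (mset_prod f)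
        = measure_pmf.expectation (R y) (\<lambda>a. measure_pmf.expectation (map_pmf (\<lambda>b. a + b) Q) (mset_prod f))"
      unfolding T_def
      by (rule expectation_bind_pmf) (simp_all add: mset_prod_nonneg mset_prod_le_1 f)
    also have "\<dots> = H f y * mset_prod (H f) j"
      by (simp add: Q[OF f] assms[rule_format, OF f])
    finally show ?thesis by simp
  qed
  then show ?case by blast
qed

lemma composition_pmf_exists:
  assumes "\<And>y. \<exists>R. \<forall>f. unit_vector f \<longrightarrow> measure_pmf.expectation R (mset_prod f) = H f y"
    and "\<And>f. unit_vector f \<Longrightarrow> unit_vector (H f)"
  shows "\<exists>R. \<forall>f. unit_vector f \<longrightarrow> measure_pmf.expectation R (mset_prod f) = progeny_gf p (H f) x"
proof -
  obtain R where R: "\<And>y. \<forall>f. unit_vector f \<longrightarrow> measure_pmf.expectation (R y) (mset_prod f) = H f y"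
    using assms by metis
  obtain Q where Q: "\<And>j f. unit_vector f \<Longrightarrow>
      measure_pmf.expectation (Q j) (mset_prod f) = mset_prod (H f) j"
    using indep_sum_pmf_exists[of R H, OF R] by metis
  have "measure_pmf.expectation (bind_pmf (p x) Q) (mset_prod f) = progeny_gf p (H f) x"
    if f: "unit_vector f" for f
  proof -
    have "measure_pmf.expectation (bind_pmf (p x) Q) (mset_prod f)
        = measure_pmf.expectation (p x) (\<lambda>j. measure_pmf.expectation (Q j) (mset_prod f))"
      by (rule expectation_bind_pmf) (simp_all add: mset_prod_nonneg mset_prod_le_1 f)
    then show ?thesis by (simp add: Q[OF f] progeny_gf_eq_expectation assms(2)[OF f])
  qed
  then show ?thesis by blast
qed

text \<open>\<open>R\<close> is the law of the population after \<open>n\<close> generations with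
  offspring law \<open>p\<close> followed by \<open>k\<close> with \<open>p'\<close>. With
  \<open>p' = frozen p A\<close> it describes the process stopped on \<open>A\<close> after
  generation \<open>n\<close>, and pointwise inequalities between several products can be integrated
  against this single law.\<close>

lemma iterate_pmf_exists:
  "\<exists>R. \<forall>f. unit_vector f \<longrightarrow> measure_pmf.expectation R (mset_prod f)
     = (progeny_gf p ^^ n) ((progeny_gf p' ^^ k) f) x"
proof (induction n arbitrary: x)
  case 0
  have "\<exists>R. \<forall>f. unit_vector f \<longrightarrow> measure_pmf.expectation R (mset_prod f)
      = (progeny_gf p' ^^ k) f x"
  proof (induction k arbitrary: x)
    case 0
    show ?case by (intro exI[of _ "return_pmf {#x#}"]) simp
  next
    case (Suc k)
    from composition_pmf_exists[where p = p' and H = "progeny_gf p' ^^ k", OF this]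
    show ?case by (simp add: unit_vector_iterate)
  qed
  then show ?case by simp
next
  case (Suc n)
  from composition_pmf_exists[where p = p
      and H = "\<lambda>f. (progeny_gf p ^^ n) ((progeny_gf p' ^^ k) f)", OF this]
  show ?case by (simp add: unit_vector_iterate)
qed

section \<open>The branching process\<close>

text \<open>Countability of the populations is what allows a generation to be treated one value at a
  time, both for measurability and for conditioning.\<close>

lemma countable_UNIV_multiset: "countable (UNIV :: 'x::countable multiset set)"
proof -
  have "surj (mset :: 'x list \<Rightarrow> _)" by (metis ex_mset surjI)
  then show ?thesis by (metis countableI_type countable_image)
qed

lemma measurable_multiset_add:
  fixes f g :: "'a \<Rightarrow> 'x::countable multiset"
  assumes "f \<in> measurable M (count_space UNIV)" "g \<in> measurable M (count_space UNIV)"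
  shows "(\<lambda>\<omega>. f \<omega> + g \<omega>) \<in> measurable M (count_space UNIV)"
proof (rule measurable_compose_countable'[OF _ assms(1) countable_UNIV_multiset])
  show "(\<lambda>\<omega>. a + g \<omega>) \<in> measurable M (count_space UNIV)" for a
    using measurable_compose[OF assms(2), of "\<lambda>b. a + b" "count_space UNIV"] by simp
qed

lemma measurable_multiset_sum:
  fixes f :: "'i \<Rightarrow> 'a \<Rightarrow> 'x::countable multiset"
  assumes "\<And>i. i \<in> I \<Longrightarrow> f i \<in> measurable M (count_space UNIV)"
  shows "(\<lambda>\<omega>. \<Sum>i\<in>I. f i \<omega>) \<in> measurable M (count_space UNIV)"
  using assms
  by (induction I rule: infinite_finite_induct) (auto intro: measurable_multiset_add)

lemma gw_space_eq: "gw_space p = PiM UNIV (\<lambda>c. measure_pmf (p (fst (snd c))))"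
  by (simp add: gw_space_def case_prod_unfold)

lemma prob_space_gw_space: "prob_space (gw_space p)"
  unfolding gw_space_eq by (intro prob_space_PiM prob_space_measure_pmf)

lemma space_gw_space [simp]: "space (gw_space p) = UNIV"
  by (simp add: gw_space_eq space_PiM)

lemma measurable_coordinate: "(\<lambda>\<omega>. \<omega> c) \<in> measurable (gw_space p) (count_space UNIV)"
proof -
  have "(\<lambda>\<omega>. \<omega> c) \<in> measurable (gw_space p) (measure_pmf (p (fst (snd c))))"
    unfolding gw_space_eq by (intro measurable_component_singleton) simp
  then show ?thesis by simp
qed

lemma distr_coordinate: "distr (gw_space p) (measure_pmf (p y)) (\<lambda>\<omega>. \<omega> (n, y, i)) = measure_pmf (p y)"
  using distr_PiM_component[of UNIV "\<lambda>c. measure_pmf (p (fst (snd c)))" "(n, y, i)"]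
  by (simp add: gw_space_eq prob_space_measure_pmf)

lemma measurable_generation:
  fixes p :: "'x::countable \<Rightarrow> 'x multiset pmf"
  shows "generation x n \<in> measurable (gw_space p) (count_space UNIV)"
proof (induction n)
  case (Suc n)
  have "(\<lambda>\<omega>. \<Sum>y\<in>set_mset N. \<Sum>i<count N y. \<omega> (n, y, i)) \<in> measurable (gw_space p) (count_space UNIV)"
    for N :: "'x multiset"
    by (intro measurable_multiset_sum measurable_coordinate)
  from measurable_compose_countable'[OF this Suc countable_UNIV_multiset] show ?case
    by simp
qed simp

lemma measurable_generation_compose:
  fixes p :: "'x::countable \<Rightarrow> 'x multiset pmf"
  assumes "range F \<subseteq> space N"
  shows "(\<lambda>\<omega>. F (generation x n \<omega>)) \<in> measurable (gw_space p) N"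
  using assms by (intro measurable_compose[OF measurable_generation, of F]) auto

section \<open>The branching property: conditioning on the current generation\<close>

lemma generation_cong:
  assumes "\<And>m y i. m < n \<Longrightarrow> \<omega> (m, y, i) = \<omega>' (m, y, i)"
  shows "generation x n \<omega> = generation x n \<omega>'"
  using assms by (induction n) auto

lemma mset_prod_sum:
  "mset_prod g (\<Sum>i\<in>I. f i) = (\<Prod>i\<in>I. mset_prod g (f i))"
  by (induction I rule: infinite_finite_induct) auto

lemma indep_vars_coordinates:
  "prob_space.indep_vars (gw_space p) (\<lambda>c. measure_pmf (p (fst (snd c)))) (\<lambda>c \<omega>. \<omega> c) UNIV"
proof -
  interpret prob_space "gw_space p" by (rule prob_space_gw_space)
  have comp: "distr (gw_space p) (measure_pmf (p (fst (snd c)))) (\<lambda>\<omega>. \<omega> c)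
      = measure_pmf (p (fst (snd c)))" for c
    using distr_coordinate[of p "fst (snd c)" "fst c" "snd (snd c)"] by simp
  show ?thesis
    by (subst indep_vars_iff_distr_eq_PiM')
       (use measurable_coordinate in \<open>auto simp: comp gw_space_eq[symmetric] restrict_UNIV distr_id\<close>)
qed

text \<open>A point of the product over \<open>K\<close> equals \<open>undefined\<close> outside
  \<open>K\<close>, so the missing coordinates are constant. A function on the full sample space can
  therefore be applied to a restricted point.\<close>

lemma measurable_ignore_coordinates:
  "(\<lambda>\<omega>. \<omega>) \<in> measurable (PiM K (\<lambda>c. measure_pmf (q c))) (PiM UNIV (\<lambda>c. measure_pmf (q c)))"
proof (rule measurable_PiM_single')
  fix c
  show "(\<lambda>\<omega>. \<omega> c) \<in> measurable (PiM K (\<lambda>c. measure_pmf (q c))) (measure_pmf (q c))"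
  proof (cases "c \<in> K")
    case True
    then show ?thesis by (rule measurable_component_singleton)
  next
    case False
    then have "\<omega> c = undefined" if "\<omega> \<in> space (PiM K (\<lambda>c. measure_pmf (q c)))" for \<omega>
      using that by (auto simp: space_PiM PiE_def extensional_def)
    then show ?thesis
      by (subst measurable_cong[where g = "\<lambda>_. undefined"]) auto
  qed
qed auto

text \<open>Once generation \<open>n\<close> is fixed to be \<open>N\<close>, the next generation
  reads finitely many known coordinates, independent of those that determine \<open>\<Psi>\<close>
  and generation \<open>n\<close>. The integral factorizes, and each individual of type
  \<open>y\<close> contributes \<open>progeny_gf p g y\<close>.\<close>

lemma nn_integral_given_generation:
  fixes p :: "'x::countable \<Rightarrow> 'x multiset pmf" and \<Psi> :: "_ \<Rightarrow> ennreal"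
  assumes g: "unit_vector g" and \<Psi>[measurable]: "\<Psi> \<in> borel_measurable (gw_space p)"
    and past: "\<And>\<omega> \<omega>'. (\<And>m y i. m < n \<Longrightarrow> \<omega> (m, y, i) = \<omega>' (m, y, i)) \<Longrightarrow> \<Psi> \<omega> = \<Psi> \<omega>'"
  shows "(\<integral>\<^sup>+ \<omega>. \<Psi> \<omega> * indicator {N} (generation x n \<omega>) * mset_prod g (generation x (Suc n) \<omega>) \<partial>gw_space p)
    = (\<integral>\<^sup>+ \<omega>. \<Psi> \<omega> * indicator {N} (generation x n \<omega>) * mset_prod (progeny_gf p g) (generation x n \<omega>) \<partial>gw_space p)"
proof -
  interpret prob_space "gw_space p" by (rule prob_space_gw_space)
  note measurable_generation[measurable] measurable_coordinate[measurable]
  define I where "I = Sigma (set_mset N) (\<lambda>y. {..<count N y})"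
  \<comment> \<open>The index \<open>None\<close> stands for the past and \<open>Some (y, i)\<close>
    for the \<open>i\<close>-th individual of type \<open>y\<close> in \<open>N\<close>. The sets
    \<open>K\<close> below are the disjoint blocks of coordinates that the factors \<open>X\<close>
    read.\<close>
  define J where "J = insert None (Some ` I)"
  define X where "X = case_option (\<lambda>\<omega>. \<Psi> \<omega> * indicator {N} (generation x n \<omega>))
    (\<lambda>(y, i) \<omega>. ennreal (mset_prod g (\<omega> (n, y, i))))"
  define K :: "('x \<times> nat) option \<Rightarrow> (nat \<times> 'x \<times> nat) set" where "K = case_option {c. fst c < n} (\<lambda>(y, i). {(n, y, i)})"
  let ?M = "\<lambda>c :: nat \<times> 'x \<times> nat. measure_pmf (p (fst (snd c)))"
  have "finite I" by (simp add: I_def)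
  have restrict: "indep_vars (\<lambda>j. PiM (K j) ?M) (\<lambda>j \<omega>. restrict (\<lambda>c. \<omega> c) (K j)) J"
    by (rule indep_vars_restrict[OF indep_vars_coordinates])
       (auto simp: disjoint_family_on_def K_def J_def)
  have X: "X j \<in> borel_measurable (gw_space p)" for j
  proof (cases j)
    case None
    then show ?thesis
      by (auto simp: X_def intro!: borel_measurable_times_ennreal \<Psi>
          measurable_generation_compose[of "\<lambda>W. indicator {N} W"])
  next
    case (Some a)
    obtain y i where a: "a = (y, i)" by (cases a)
    have "(\<lambda>\<omega>. ennreal (mset_prod g (\<omega> (n, y, i)))) \<in> borel_measurable (gw_space p)"
      by (rule measurable_compose[OF measurable_coordinate]) simp
    then show ?thesis by (simp add: X_def Some a)
  qed
  have "indep_vars (\<lambda>_. borel) (\<lambda>j \<omega>. X j (restrict (\<lambda>c. \<omega> c) (K j))) J"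
  proof (rule indep_vars_compose2[OF restrict])
    fix j assume "j \<in> J"
    show "X j \<in> borel_measurable (PiM (K j) ?M)"
      using X[of j]
      unfolding gw_space_eq by (rule measurable_compose[OF measurable_ignore_coordinates])
  qed
  \<comment> \<open>Each factor reads only its own block, so the restriction can be undone.\<close>
  also have "?this \<longleftrightarrow> indep_vars (\<lambda>_. borel) X J"
  proof (rule indep_vars_cong[OF refl _ refl])
    fix j assume "j \<in> J"
    show "(\<lambda>\<omega>. X j (restrict (\<lambda>c. \<omega> c) (K j))) = X j"
    proof (cases j)
      case None
      have "generation x n (restrict \<omega> {c. fst c < n}) = generation x n \<omega>"
        "\<Psi> (restrict \<omega> {c. fst c < n}) = \<Psi> \<omega>" for \<omega>
        by (auto intro!: generation_cong past)
      then show ?thesis by (simp add: None X_def K_def)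
    qed (auto simp: X_def K_def)
  qed
  finally have indep: "indep_vars (\<lambda>_. borel) X J" .
  have coord: "(\<integral>\<^sup>+ \<omega>. mset_prod g (\<omega> (n, y, i)) \<partial>gw_space p) = ennreal (progeny_gf p g y)" for y i
  proof -
    have "(\<integral>\<^sup>+ \<omega>. mset_prod g (\<omega> (n, y, i)) \<partial>gw_space p)
        = (\<integral>\<^sup>+ j. mset_prod g j \<partial>distr (gw_space p) (measure_pmf (p y)) (\<lambda>\<omega>. \<omega> (n, y, i)))"
      using measurable_coordinate[of "(n, y, i)" p] by (subst nn_integral_distr) auto
    also have "\<dots> = ennreal (progeny_gf p g y)"
      unfolding distr_coordinate progeny_gf_eq_expectation[OF g]
      by (intro nn_integral_eq_integral integrable_mset_prod g) (simp add: mset_prod_nonneg g)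
    finally show ?thesis .
  qed
  have coord': "(\<integral>\<^sup>+ \<omega>. mset_prod g (\<omega> (n, a)) \<partial>gw_space p) = ennreal (progeny_gf p g (fst a))" for a
    using coord[of "fst a" "snd a"] by simp
  have uG: "unit_vector (progeny_gf p g)" using g by (rule unit_vector_progeny_gf)
  have "(\<Prod>j\<in>J. X j \<omega>) = X None \<omega> * (\<Prod>(y, i)\<in>I. ennreal (mset_prod g (\<omega> (n, y, i))))" for \<omega>
    by (simp add: J_def \<open>finite I\<close> prod.reindex X_def case_prod_beta)
  also have "\<dots> \<omega> = \<Psi> \<omega> * indicator {N} (generation x n \<omega>) * mset_prod g (generation x (Suc n) \<omega>)" for \<omega>
    by (auto simp: X_def indicator_def I_def mset_prod_sum prod.Sigma case_prod_beta prod_ennreal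
        mset_prod_nonneg g)
  finally have "(\<integral>\<^sup>+ \<omega>. \<Psi> \<omega> * indicator {N} (generation x n \<omega>) * mset_prod g (generation x (Suc n) \<omega>) \<partial>gw_space p)
      = (\<integral>\<^sup>+ \<omega>. (\<Prod>j\<in>J. X j \<omega>) \<partial>gw_space p)" by simp
  also have "\<dots> = (\<Prod>j\<in>J. \<integral>\<^sup>+ \<omega>. X j \<omega> \<partial>gw_space p)"
    by (intro indep_vars_nn_integral indep) (simp_all add: J_def \<open>finite I\<close>)
  also have "\<dots> = (\<integral>\<^sup>+ \<omega>. X None \<omega> \<partial>gw_space p) * (\<Prod>(y, i)\<in>I. ennreal (progeny_gf p g y))"
    by (simp add: J_def \<open>finite I\<close> prod.reindex X_def case_prod_beta coord')
  also have "(\<Prod>(y, i)\<in>I. ennreal (progeny_gf p g y)) = ennreal (mset_prod (progeny_gf p g) N)"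
    using unit_vectorD[OF uG]
    by (simp add: I_def prod.Sigma[symmetric] image_prod_mset_multiplicity prod_ennreal ennreal_power)
  also have "(\<integral>\<^sup>+ \<omega>. X None \<omega> \<partial>gw_space p) * ennreal (mset_prod (progeny_gf p g) N)
      = (\<integral>\<^sup>+ \<omega>. X None \<omega> * ennreal (mset_prod (progeny_gf p g) N) \<partial>gw_space p)"
    using X by (rule nn_integral_multc[symmetric])
  also have "\<dots> = (\<integral>\<^sup>+ \<omega>. \<Psi> \<omega> * indicator {N} (generation x n \<omega>)
      * mset_prod (progeny_gf p g) (generation x n \<omega>) \<partial>gw_space p)"
    by (intro nn_integral_cong) (simp add: X_def indicator_def)
  finally show ?thesis .
qed

text \<open>The previous lemma is summed over the countably many values of generation
  \<open>n\<close>. The weight \<open>\<Psi>\<close> may depend on generations up to and including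
  \<open>n\<close>, as these are determined by the coordinates below \<open>n\<close>.\<close>

lemma nn_integral_one_step:
  fixes p :: "'x::countable \<Rightarrow> 'x multiset pmf" and \<Psi> :: "_ \<Rightarrow> ennreal"
  assumes g: "unit_vector g" and \<Psi>[measurable]: "\<Psi> \<in> borel_measurable (gw_space p)"
    and past: "\<And>\<omega> \<omega>'. (\<And>m y i. m < n \<Longrightarrow> \<omega> (m, y, i) = \<omega>' (m, y, i)) \<Longrightarrow> \<Psi> \<omega> = \<Psi> \<omega>'"
  shows "(\<integral>\<^sup>+ \<omega>. \<Psi> \<omega> * mset_prod g (generation x (Suc n) \<omega>) \<partial>gw_space p)
    = (\<integral>\<^sup>+ \<omega>. \<Psi> \<omega> * mset_prod (progeny_gf p g) (generation x n \<omega>) \<partial>gw_space p)"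
proof -
  note measurable_generation[measurable]
  have split: "(\<integral>\<^sup>+ \<omega>. \<Psi> \<omega> * mset_prod f (generation x m \<omega>) \<partial>gw_space p)
      = (\<integral>\<^sup>+ N. \<integral>\<^sup>+ \<omega>. \<Psi> \<omega> * indicator {N} (generation x n \<omega>) * mset_prod f (generation x m \<omega>)
          \<partial>gw_space p \<partial>count_space UNIV)" for f m
  proof -
    have "(\<integral>\<^sup>+ \<omega>. \<Psi> \<omega> * mset_prod f (generation x m \<omega>) \<partial>gw_space p)
      = (\<integral>\<^sup>+ \<omega>. \<integral>\<^sup>+ N. \<Psi> \<omega> * indicator {N} (generation x n \<omega>) * mset_prod f (generation x m \<omega>)
          \<partial>count_space UNIV \<partial>gw_space p)"
    proof (rule nn_integral_cong)
      fix \<omega>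
      have "(\<integral>\<^sup>+ N. \<Psi> \<omega> * indicator {N} (generation x n \<omega>) * mset_prod f (generation x m \<omega>) \<partial>count_space UNIV)
        = (\<integral>\<^sup>+ N. (\<Psi> \<omega> * mset_prod f (generation x m \<omega>)) * indicator {generation x n \<omega>} N \<partial>count_space UNIV)"
        by (intro nn_integral_cong) (simp add: indicator_def)
      also have "\<dots> = \<Psi> \<omega> * mset_prod f (generation x m \<omega>)"
        by (subst nn_integral_cmult_indicator) auto
      finally show "\<Psi> \<omega> * mset_prod f (generation x m \<omega>) = (\<integral>\<^sup>+ N. \<Psi> \<omega> * indicator {N} (generation x n \<omega>)
          * mset_prod f (generation x m \<omega>) \<partial>count_space UNIV)" by simp
    qed
    also have "\<dots> = (\<integral>\<^sup>+ N. \<integral>\<^sup>+ \<omega>. \<Psi> \<omega> * indicator {N} (generation x n \<omega>) * mset_prod f (generation x m \<omega>)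
          \<partial>gw_space p \<partial>count_space UNIV)"
      by (intro nn_integral_count_space_nn_integral countable_UNIV_multiset borel_measurable_times_ennreal
          \<Psi> measurable_generation_compose[of "\<lambda>W. indicator {N} W" for N]
          measurable_generation_compose[of "\<lambda>W. ennreal (mset_prod f W)"]) simp_all
    finally show ?thesis .
  qed
  show ?thesis
    unfolding split by (rule nn_integral_cong, rule nn_integral_given_generation[OF assms])
qed

lemma nn_integral_generation:
  fixes p :: "'x::countable \<Rightarrow> 'x multiset pmf"
  assumes "unit_vector f"
  shows "(\<integral>\<^sup>+ \<omega>. mset_prod f (generation x n \<omega>) \<partial>gw_space p) = ennreal ((progeny_gf p ^^ n) f x)"
  using assms
proof (induction n arbitrary: f)
  case 0
  interpret prob_space "gw_space p" by (rule prob_space_gw_space)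
  show ?case using emeasure_space_1 by simp
next
  case (Suc n)
  have "(\<integral>\<^sup>+ \<omega>. mset_prod f (generation x (Suc n) \<omega>) \<partial>gw_space p)
      = (\<integral>\<^sup>+ \<omega>. mset_prod (progeny_gf p f) (generation x n \<omega>) \<partial>gw_space p)"
    using nn_integral_one_step[OF Suc.prems, of "\<lambda>_. 1" p n x] by (simp del: generation.simps)
  with Suc.IH[OF unit_vector_progeny_gf[OF Suc.prems, of p]] show ?case
    by (simp add: funpow_swap1 del: generation.simps)
qed

section \<open>Avoiding a set of types, and extinction as eventual avoidance\<close>

abbreviation avoids where
  "avoids x A I \<omega> \<equiv> \<forall>m\<in>I. set_mset (generation x m \<omega>) \<inter> A = {}"

lemma sets_avoids:
  fixes p :: "'x::countable \<Rightarrow> 'x multiset pmf"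
  shows "{\<omega>. avoids x A I \<omega>} \<in> sets (gw_space p)"
proof -
  have "Measurable.pred (gw_space p) (\<lambda>\<omega>. set_mset (generation x m \<omega>) \<inter> A = {})" for m
    by (rule measurable_generation_compose) simp
  then have "{\<omega> \<in> space (gw_space p). avoids x A I \<omega>} \<in> sets (gw_space p)"
    by (intro sets.sets_Collect_countable_Ball) (simp_all add: pred_def)
  then show ?thesis by simp
qed

text \<open>Read backwards from generation \<open>n + k\<close>: as \<open>f\<close> vanishes on
  \<open>A\<close>, the product of \<open>progeny_gf (frozen p A) f\<close> is zero once the
  population meets \<open>A\<close>, and equals the product of \<open>progeny_gf p f\<close>
  otherwise. Each freezing step thus absorbs one avoidance condition, and the new vector again
  vanishes on \<open>A\<close>.\<close>

lemma nn_integral_avoids: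
  fixes p :: "'x::countable \<Rightarrow> 'x multiset pmf"
  assumes "unit_vector f" and "\<And>y. y \<in> A \<Longrightarrow> f y = 0"
  shows "(\<integral>\<^sup>+ \<omega>. indicator {\<omega>. avoids x A {n..<n + k} \<omega>} \<omega> * ennreal (mset_prod f (generation x (n + k) \<omega>)) \<partial>gw_space p)
    = (\<integral>\<^sup>+ \<omega>. mset_prod ((progeny_gf (frozen p A) ^^ k) f) (generation x n \<omega>) \<partial>gw_space p)"
  using assms
proof (induction k arbitrary: f)
  case (Suc k)
  let ?\<Psi> = "\<lambda>\<omega>. indicator {\<omega>. avoids x A {n..<n + Suc k} \<omega>} \<omega> :: ennreal"
  have \<Psi>: "?\<Psi> \<in> borel_measurable (gw_space p)"
    using sets_avoids by (rule borel_measurable_indicator)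
  \<comment> \<open>The last generation in the window is \<open>n + k\<close>, which depends only on
    coordinates below \<open>n + k\<close>; so the one-step lemma applies at generation
    \<open>n + k\<close>.\<close>
  have past: "?\<Psi> \<omega> = ?\<Psi> \<omega>'" if "\<And>m y i. m < n + k \<Longrightarrow> \<omega> (m, y, i) = \<omega>' (m, y, i)" for \<omega> \<omega>'
  proof -
    have gen: "generation x m \<omega> = generation x m \<omega>'" if "m \<in> {n..<n + Suc k}" for m
      using that \<open>\<And>m y i. m < n + k \<Longrightarrow> \<omega> (m, y, i) = \<omega>' (m, y, i)\<close> by (intro generation_cong) auto
    have "avoids x A {n..<n + Suc k} \<omega> \<longleftrightarrow> avoids x A {n..<n + Suc k} \<omega>'"
      by (rule ball_cong[OF refl]) (simp only: gen)
    then show ?thesis unfolding indicator_def mem_Collect_eq by (simp only:)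
  qed
  have frozen: "mset_prod (progeny_gf (frozen p A) f) W
      = indicator {W. set_mset W \<inter> A = {}} W * mset_prod (progeny_gf p f) W" for W
  proof (cases "set_mset W \<inter> A = {}")
    case True
    then have "progeny_gf (frozen p A) f y = progeny_gf p f y" if "y \<in># W" for y
      using that by (auto simp: progeny_gf_frozen Suc.prems)
    with True show ?thesis by (simp cong: image_mset_cong)
  next
    case False
    then obtain y where "y \<in># W" "y \<in> A" by blast
    then have "progeny_gf (frozen p A) f y = 0" by (simp add: progeny_gf_frozen Suc.prems)
    with \<open>y \<in># W\<close> False show ?thesis by (auto simp: prod_mset_zero_iff image_iff)
  qed
  have "(\<integral>\<^sup>+ \<omega>. ?\<Psi> \<omega> * mset_prod f (generation x (n + Suc k) \<omega>) \<partial>gw_space p)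
      = (\<integral>\<^sup>+ \<omega>. ?\<Psi> \<omega> * mset_prod (progeny_gf p f) (generation x (n + k) \<omega>) \<partial>gw_space p)"
    using nn_integral_one_step[OF Suc.prems(1) \<Psi> past] by (simp del: generation.simps)
  also have "\<dots> = (\<integral>\<^sup>+ \<omega>. indicator {\<omega>. avoids x A {n..<n + k} \<omega>} \<omega>
      * ennreal (mset_prod (progeny_gf (frozen p A) f) (generation x (n + k) \<omega>)) \<partial>gw_space p)"
    by (intro nn_integral_cong) (auto simp: frozen indicator_def atLeastLessThanSuc)
  also have "\<dots> = (\<integral>\<^sup>+ \<omega>. mset_prod ((progeny_gf (frozen p A) ^^ Suc k) f) (generation x n \<omega>) \<partial>gw_space p)"
    unfolding funpow_Suc_right comp_apply
    using Suc.prems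
    by (intro Suc.IH unit_vector_progeny_gf) (auto simp: progeny_gf_frozen)
  finally show ?case .
qed simp

lemma unit_vector_indicator: "unit_vector (indicat_real A)"
  by (simp add: unit_vector_def)

text \<open>The probability that \<open>A\<close> is not visited in generations \<open>n\<close> to
  \<open>n + k\<close>: first \<open>n\<close> free generations, then \<open>k\<close> stopped on
  \<open>A\<close>, and finally a test that the population misses \<open>A\<close>.\<close>

definition avoid :: "('x \<Rightarrow> 'x multiset pmf) \<Rightarrow> 'x set \<Rightarrow> nat \<Rightarrow> nat \<Rightarrow> 'x \<Rightarrow> real" where
  "avoid p A n k = (progeny_gf p ^^ n) ((progeny_gf (frozen p A) ^^ k) (indicat_real (- A)))"

lemma unit_vector_avoid: "unit_vector (avoid p A n k)"
  by (simp add: avoid_def unit_vector_iterate unit_vector_indicator)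

lemma prob_avoids:
  fixes p :: "'x::countable \<Rightarrow> 'x multiset pmf"
  shows "measure (gw_space p) {\<omega>. avoids x A {n..n + k} \<omega>} = avoid p A n k x"
proof -
  interpret prob_space "gw_space p" by (rule prob_space_gw_space)
  have ind: "mset_prod (indicat_real (- A)) W = indicator {W. set_mset W \<inter> A = {}} W" for W
    by (induction W) (auto simp: indicator_def)
  \<comment> \<open>The window of \<open>nn_integral_avoids\<close> is half-open; the indicator
    vector of the complement of \<open>A\<close> supplies the condition on generation
    \<open>n + k\<close>.\<close>
  have last: "{n..n + k} = insert (n + k) {n..<n + k}" by auto
  have "ennreal (measure (gw_space p) {\<omega>. avoids x A {n..n + k} \<omega>})
      = (\<integral>\<^sup>+ \<omega>. indicator {\<omega>. avoids x A {n..n + k} \<omega>} \<omega> \<partial>gw_space p)"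
    by (simp add: sets_avoids emeasure_eq_measure)
  also have "\<dots> = (\<integral>\<^sup>+ \<omega>. indicator {\<omega>. avoids x A {n..<n + k} \<omega>} \<omega>
      * ennreal (mset_prod (indicat_real (- A)) (generation x (n + k) \<omega>)) \<partial>gw_space p)"
    unfolding ind
    by (intro nn_integral_cong) (auto simp: indicator_def last)
  also have "\<dots> = ennreal (avoid p A n k x)"
    by (simp add: nn_integral_avoids nn_integral_generation unit_vector_indicator unit_vector_iterate
        avoid_def)
  finally show ?thesis
    using unit_vectorD(1)[OF unit_vector_avoid, of p A n k x] by simp
qed

text \<open>The counts are integers, so they converge to 0 only by being 0 from some generation
  on.\<close>

lemma extinct_in_iff: "extinct_in x A \<omega> \<longleftrightarrow> (\<exists>n. avoids x A {n..} \<omega>)"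
proof -
  have "extinct_in x A \<omega> \<longleftrightarrow>
      (\<forall>\<^sub>F n in sequentially. size (filter_mset (\<lambda>y. y \<in> A) (generation x n \<omega>)) = 0)"
  proof
    assume "extinct_in x A \<omega>"
    from order_tendstoD(2)[OF this[unfolded extinct_in_def], of 1]
    show "\<forall>\<^sub>F n in sequentially. size (filter_mset (\<lambda>y. y \<in> A) (generation x n \<omega>)) = 0"
      by simp
  next
    assume "\<forall>\<^sub>F n in sequentially. size (filter_mset (\<lambda>y. y \<in> A) (generation x n \<omega>)) = 0"
    then show "extinct_in x A \<omega>"
      unfolding extinct_in_def by (intro tendsto_eventually) (auto elim: eventually_mono)
  qed
  also have "\<dots> \<longleftrightarrow> (\<exists>n. avoids x A {n..} \<omega>)"
    by (auto simp: eventually_sequentially filter_mset_eq_mempty_iff disjoint_iff)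
  finally show ?thesis .
qed

lemma extinct_in_antimono: "extinct_in x B \<omega> \<Longrightarrow> A \<subseteq> B \<Longrightarrow> extinct_in x A \<omega>"
  unfolding extinct_in_iff by blast

lemma sets_extinct_in:
  fixes p :: "'x::countable \<Rightarrow> 'x multiset pmf"
  shows "{\<omega>. extinct_in x A \<omega>} \<in> sets (gw_space p)"
proof -
  have "{\<omega>. extinct_in x A \<omega>} = (\<Union>n. {\<omega>. avoids x A {n..} \<omega>})"
    by (auto simp: extinct_in_iff)
  then show ?thesis using sets_avoids by (auto intro!: sets.countable_UN)
qed

lemma ext_prob_eq: "ext_prob p A x = measure (gw_space p) {\<omega>. extinct_in x A \<omega>}"
  by (simp add: ext_prob_def)

text \<open>Extinction is an increasing union over \<open>n\<close> of decreasing intersections over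
  \<open>k\<close>, so continuity of measure gives an iterated limit. Through it, properties of
  iterated generating functions pass to extinction probabilities.\<close>

lemma ext_prob_limit_exists:
  fixes p :: "'x::countable \<Rightarrow> 'x multiset pmf"
  obtains L where "\<And>n x. (\<lambda>k. avoid p A n k x) \<longlonglongrightarrow> L n x"
    and "\<And>x. (\<lambda>n. L n x) \<longlonglongrightarrow> ext_prob p A x"
proof
  interpret prob_space "gw_space p" by (rule prob_space_gw_space)
  let ?L = "\<lambda>n x. measure (gw_space p) {\<omega>. avoids x A {n..} \<omega>}"
  show "(\<lambda>k. avoid p A n k x) \<longlonglongrightarrow> ?L n x" for n x
  proof -
    have "{n..} = (\<Union>k. {n..n + k})"
      by (auto simp: le_iff_add) blast
    then have "{\<omega>. avoids x A {n..} \<omega>} = (\<Inter>k. {\<omega>. avoids x A {n..n + k} \<omega>})"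
      by auto
    moreover have "decseq (\<lambda>k. {\<omega>. avoids x A {n..n + k} \<omega>})"
      by (auto simp: decseq_def)
    ultimately show ?thesis
      using finite_Lim_measure_decseq[of "\<lambda>k. {\<omega>. avoids x A {n..n + k} \<omega>}"]
        sets_avoids[where p = p and x = x and A = A]
      by (simp add: prob_avoids image_subset_iff)
  qed
  show "(\<lambda>n. ?L n x) \<longlonglongrightarrow> ext_prob p A x" for x
  proof -
    have "{\<omega>. extinct_in x A \<omega>} = (\<Union>n. {\<omega>. avoids x A {n..} \<omega>})"
      by (auto simp: extinct_in_iff)
    moreover have "incseq (\<lambda>n. {\<omega>. avoids x A {n..} \<omega>})"
      by (auto simp: incseq_def)
    ultimately show ?thesis
      using finite_Lim_measure_incseq[of "\<lambda>n. {\<omega>. avoids x A {n..} \<omega>}"]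
        sets_avoids[where p = p and x = x and A = A]
      by (simp add: ext_prob_eq image_subset_iff)
  qed
qed

lemma ext_prob_antimono:
  fixes p :: "'x::countable \<Rightarrow> 'x multiset pmf"
  assumes "A \<subseteq> B"
  shows "ext_prob p B x \<le> ext_prob p A x"
proof -
  interpret prob_space "gw_space p" by (rule prob_space_gw_space)
  show ?thesis
    unfolding ext_prob_eq using assms
    by (intro finite_measure_mono sets_extinct_in) (auto intro: extinct_in_antimono)
qed

text \<open>Every finite set of types lies in a sublevel set of \<open>to_nat\<close>, so the
  intersection over all finite sets is a decreasing countable one.\<close>

lemma tendsto_partial_ext_prob:
  fixes p :: "'x::countable \<Rightarrow> 'x multiset pmf"
  shows "(\<lambda>n. ext_prob p {y. to_nat y \<le> n} x) \<longlonglongrightarrow> partial_ext_prob p x"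
proof -
  interpret prob_space "gw_space p" by (rule prob_space_gw_space)
  let ?A = "\<lambda>n. {y::'x. to_nat y \<le> n}"
  have finite: "finite (?A n)" for n
    using finite_vimageI[OF finite_atMost[of n] inj_to_nat] by (simp add: vimage_def)
  have "A \<subseteq> ?A (Max (to_nat ` A))" if "finite A" for A
    using that by auto
  then have "extinct_in x A \<omega>" if "\<forall>n. extinct_in x (?A n) \<omega>" "finite A" for A \<omega>
    using that by (blast intro: extinct_in_antimono)
  then have "{\<omega>. \<forall>A. finite A \<longrightarrow> extinct_in x A \<omega>} = (\<Inter>n. {\<omega>. extinct_in x (?A n) \<omega>})"
    using finite by auto
  moreover have "decseq (\<lambda>n. {\<omega>. extinct_in x (?A n) \<omega>})"
    by (auto simp: decseq_def intro: extinct_in_antimono)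
  ultimately show ?thesis
    using finite_Lim_measure_decseq[of "\<lambda>n. {\<omega>. extinct_in x (?A n) \<omega>}"]
      sets_extinct_in[where p = p and x = x]
    unfolding ext_prob_eq partial_ext_prob_def by (simp add: image_subset_iff)
qed

text \<open>A mean is positive exactly when some offspring multiset of positive probability contains
  the type. Paths can then be followed birth by birth.\<close>

lemma leads_to_eq: "leads_to p = (\<lambda>x y. \<exists>j\<in>set_pmf (p x). y \<in># j)\<^sup>*\<^sup>*"
proof -
  have "mean_offspring p x y > 0 \<longleftrightarrow> (\<exists>j\<in>set_pmf (p x). y \<in># j)" for x y
  proof -
    have "mean_offspring p x y = (\<integral>\<^sup>+ j. of_nat (count j y)
        \<partial>distr (gw_space p) (measure_pmf (p x)) (\<lambda>\<omega>. \<omega> (0, x, 0)))"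
      using measurable_coordinate[of "(0, x, 0)" p]
      by (subst nn_integral_distr) (auto simp: mean_offspring_def)
    also have "\<dots> = (\<integral>\<^sup>+ j. of_nat (count j y) \<partial>measure_pmf (p x))"
      by (simp add: distr_coordinate)
    also have "\<dots> = 0 \<longleftrightarrow> (\<forall>j\<in>set_pmf (p x). y \<notin># j)"
      by (subst nn_integral_0_iff_AE) (auto simp: AE_measure_pmf_iff not_in_iff)
    finally show ?thesis by (auto simp: zero_less_iff_neq_zero)
  qed
  then show ?thesis by (simp add: leads_to_def)
qed

lemma prob_first_generation:
  "\<P>(\<omega> in gw_space p. P (generation y 1 \<omega>)) = measure_pmf.prob (p y) {j. P j}"
proof -
  have "measure (distr (gw_space p) (measure_pmf (p y)) (\<lambda>\<omega>. \<omega> (0, y, 0))) {j. P j}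
      = measure (gw_space p) {\<omega>. P (\<omega> (0, y, 0))}"
    using measurable_coordinate[of "(0, y, 0)" p]
    by (subst measure_distr) (auto simp: vimage_def)
  then show ?thesis by (simp add: distr_coordinate)
qed

section \<open>Extinction probability vectors\<close>

lemma avoid_Suc: "avoid p A (Suc n) k = progeny_gf p (avoid p A n k)"
  by (simp add: avoid_def)

text \<open>One more free generation is one more application of the generating function, which is
  continuous under bounded pointwise limits; let \<open>k\<close> and then \<open>n\<close> tend to
  infinity.\<close>

lemma ext_prob_fixed_point:
  fixes p :: "'x::countable \<Rightarrow> 'x multiset pmf"
  shows "ext_prob p A \<in> fixed_points p"
proof -
  obtain L where L: "\<And>n x. (\<lambda>k. avoid p A n k x) \<longlonglongrightarrow> L n x"
      "\<And>x. (\<lambda>n. L n x) \<longlonglongrightarrow> ext_prob p A x"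
    by (rule ext_prob_limit_exists[of p A]) blast
  have uL: "unit_vector (L n)" for n
    using unit_vector_avoid L(1) by (rule unit_vector_limit)
  have uE: "unit_vector (ext_prob p A)"
    using uL L(2) by (rule unit_vector_limit)
  have Suc: "L (Suc n) x = progeny_gf p (L n) x" for n x
    using L(1)[of "Suc n" x] tendsto_progeny_gf[OF unit_vector_avoid uL L(1), of p n x]
    unfolding avoid_Suc by (rule LIMSEQ_unique)
  have "progeny_gf p (ext_prob p A) x = ext_prob p A x" for x
    using tendsto_progeny_gf[OF uL uE L(2), of p x] LIMSEQ_Suc[OF L(2)[of x]]
    unfolding Suc by (rule LIMSEQ_unique)
  with uE show ?thesis by (simp add: fixed_points_iff fun_eq_iff)
qed

lemma progeny_gf_eq_1_on:
  assumes "unit_vector f" "\<And>v j. v \<in> B \<Longrightarrow> j \<in> set_pmf (p v) \<Longrightarrow> set_mset j \<subseteq> B"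
    and "\<And>v. v \<in> B \<Longrightarrow> f v = 1" and "v \<in> B"
  shows "progeny_gf p f v = 1"
  unfolding progeny_gf_eq_1_iff[OF assms(1)]
proof
  fix j assume "j \<in> set_pmf (p v)"
  then have "set_mset j \<subseteq> B" using assms by blast
  then have "\<And>y. y \<in># j \<Longrightarrow> f y = 1" using assms by blast
  then show "mset_prod f j = 1" by (simp cong: image_mset_cong)
qed

lemma iterate_eq_1_on:
  assumes "unit_vector f" "\<And>v j. v \<in> B \<Longrightarrow> j \<in> set_pmf (p v) \<Longrightarrow> set_mset j \<subseteq> B"
    and "\<And>v. v \<in> B \<Longrightarrow> f v = 1" and "v \<in> B"
  shows "(progeny_gf p ^^ n) f v = 1"
  using assms(4)
proof (induction n arbitrary: v)
  case (Suc n)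
  then show ?case
    by (simp, intro progeny_gf_eq_1_on[where B = B]) (auto simp: unit_vector_iterate assms)
qed (simp add: assms)

lemma ext_prob_eq_1_on_closed:
  fixes p :: "'x::countable \<Rightarrow> 'x multiset pmf"
  assumes closed: "\<And>v j. v \<in> B \<Longrightarrow> j \<in> set_pmf (p v) \<Longrightarrow> set_mset j \<subseteq> B"
    and "A \<inter> B = {}" and "v \<in> B"
  shows "ext_prob p A v = 1"
proof -
  have one: "(progeny_gf (frozen p A) ^^ k) (indicat_real (- A)) w = 1" if "w \<in> B" for k w
    using _ _ _ that
  proof (rule iterate_eq_1_on)
    fix v j assume "v \<in> B" "j \<in> set_pmf (frozen p A v)"
    then show "set_mset j \<subseteq> B" using closed[of v j] by (auto simp: frozen_def split: if_splits)
  qed (use assms(2) in \<open>auto simp: unit_vector_indicator indicator_def\<close>)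
  then have avoid: "avoid p A n k v = 1" for n k
    unfolding avoid_def
    using unit_vector_iterate[OF unit_vector_indicator] closed one
    by (intro iterate_eq_1_on[where B = B and f = "(progeny_gf (frozen p A) ^^ k) (indicat_real (- A))"])
       (auto simp: \<open>v \<in> B\<close>)
  obtain L where L: "\<And>n x. (\<lambda>k. avoid p A n k x) \<longlonglongrightarrow> L n x"
      "\<And>x. (\<lambda>n. L n x) \<longlonglongrightarrow> ext_prob p A x"
    by (rule ext_prob_limit_exists[of p A]) blast
  have "L n v = 1" for n
    using L(1)[of n v] by (simp add: avoid LIMSEQ_const_iff)
  with L(2)[of v] show ?thesis by (simp add: LIMSEQ_const_iff)
qed

lemma global_ext_prob_le:
  fixes p :: "'x::countable \<Rightarrow> 'x multiset pmf"
  assumes "unit_vector z" "\<And>x. progeny_gf p z x \<le> z x"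
  shows "global_ext_prob p x \<le> z x"
proof -
  have frozen: "(progeny_gf (frozen p UNIV) ^^ k) (indicat_real {}) = indicat_real {}" for k
  proof (rule iterate_fixed, rule ext)
    show "progeny_gf (frozen p UNIV) (indicat_real {}) y = indicat_real {} y" for y
      using progeny_gf_frozen[OF unit_vector_indicator, of p UNIV "{}" y] by simp
  qed
  have "avoid p UNIV n k x \<le> z x" for n k x
  proof (induction n arbitrary: x)
    case 0
    show ?case using unit_vectorD[OF assms(1)] by (simp add: avoid_def frozen)
  next
    case (Suc n)
    have "avoid p UNIV (Suc n) k x \<le> progeny_gf p z x"
      unfolding avoid_Suc using Suc by (intro progeny_gf_mono unit_vector_avoid assms)
    with assms(2)[of x] show ?case by simp
  qed
  note le = this
  obtain L where L: "\<And>n x. (\<lambda>k. avoid p UNIV n k x) \<longlonglongrightarrow> L n x"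
      "\<And>x. (\<lambda>n. L n x) \<longlonglongrightarrow> ext_prob p UNIV x"
    by (rule ext_prob_limit_exists[of p UNIV]) blast
  have "L n x \<le> z x" for n
    using L(1)[of n x] le by (intro LIMSEQ_le_const2) auto
  then show ?thesis
    unfolding global_ext_prob_def using L(2)[of x] by (intro LIMSEQ_le_const2) auto
qed

section \<open>Second moments and upper bounds on fixed points\<close>

lemma second_moment_exists:
  assumes "s \<in> fixed_points p"
  obtains t where "t \<in> fixed_points p" "\<And>x. (s x)\<^sup>2 \<le> t x"
    "\<And>x. (\<lambda>n. (progeny_gf p ^^ n) (\<lambda>y. (s y)\<^sup>2) x) \<longlonglongrightarrow> t x"
proof -
  let ?f = "\<lambda>n. (progeny_gf p ^^ n) (\<lambda>y. (s y)\<^sup>2)"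
  have u: "unit_vector s" and fixed: "progeny_gf p s = s"
    using assms by (auto simp: fixed_points_iff)
  note u2 = unit_vector_square[OF u]
  have uf: "unit_vector (?f n)" for n using u2 by (rule unit_vector_iterate)
  \<comment> \<open>Since \<open>s\<close> is fixed, nonnegativity of the variance puts its square
    below the image of the square, and monotone iteration keeps this order.\<close>
  have "incseq (\<lambda>n. ?f n x)" for x
  proof (rule incseq_SucI)
    fix n
    have "?f n x \<le> (progeny_gf p ^^ n) (progeny_gf p (\<lambda>y. (s y)\<^sup>2)) x"
      using progeny_gf_square_ge[OF u, of p]
      by (intro iterate_mono u2 unit_vector_progeny_gf) (simp add: fixed)
    then show "?f n x \<le> ?f (Suc n) x" by (simp add: funpow_swap1)
  qed
  moreover from this have "(s x)\<^sup>2 \<le> ?f n x" for n x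
    by (metis (no_types, lifting) funpow_0 incseqD le0)
  ultimately have "\<exists>l. (\<lambda>n. ?f n x) \<longlonglongrightarrow> l \<and> (s x)\<^sup>2 \<le> l" for x
    using incseq_convergent[of "\<lambda>n. ?f n x" 1] unit_vectorD[OF uf]
    by (metis (no_types, lifting) LIMSEQ_le_const)
  then obtain t where t: "\<And>x. (\<lambda>n. ?f n x) \<longlonglongrightarrow> t x" "\<And>x. (s x)\<^sup>2 \<le> t x"
    by metis
  have ut: "unit_vector t" using uf t(1) by (rule unit_vector_limit)
  have "progeny_gf p t x = t x" for x
    using tendsto_progeny_gf[OF uf ut t(1), of p x] LIMSEQ_Suc[OF t(1)[of x]]
    by simp (rule LIMSEQ_unique)
  with ut have "t \<in> fixed_points p" by (simp add: fixed_points_iff fun_eq_iff)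
  from this t(2,1) show thesis by (rule that)
qed

text \<open>A pointwise bound on the product of \<open>s\<close> over the stopped population
  \<open>W\<close> is averaged. If \<open>W\<close> misses \<open>A\<close>, the indicator term
  suffices; if it meets \<open>A\<close>, the gap between the product of \<open>t\<close> and the
  squared product of \<open>s\<close> controls the latter. The expected gap is at most the numerator
  of the last term.\<close>

lemma fixed_point_le_avoid:
  assumes s: "s \<in> fixed_points p" and t: "t \<in> fixed_points p"
    and le: "\<And>y. (s y)\<^sup>2 \<le> t y" and "\<delta> > 0" and A: "\<And>y. y \<in> A \<Longrightarrow> (1 + \<delta>) * (s y)\<^sup>2 \<le> t y"
    and "\<eta> > 0"
  shows "s x \<le> avoid p A n k x + \<eta> + (t x - (progeny_gf p ^^ n) (\<lambda>y. (s y)\<^sup>2) x) / (\<eta> * \<delta>)"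
proof -
  have us: "unit_vector s" and ut: "unit_vector t" using s t by (auto simp: fixed_points_iff)
  note us2 = unit_vector_square[OF us]
  obtain R where R: "\<And>f. unit_vector f \<Longrightarrow> measure_pmf.expectation R (mset_prod f)
      = (progeny_gf p ^^ n) ((progeny_gf (frozen p A) ^^ k) f) x"
    using iterate_pmf_exists[of n p k "frozen p A" x] by blast
  have frozen: "progeny_gf (frozen p A) f = f" if "f \<in> fixed_points p" for f
    using that by (auto simp: fun_eq_iff progeny_gf_frozen fixed_points_iff)
  have fixed: "measure_pmf.expectation R (mset_prod f) = f x" if "f \<in> fixed_points p" for f
    using that by (simp add: R fixed_points_iff iterate_fixed frozen)
  let ?s2 = "\<lambda>y. (s y)\<^sup>2"
  have step: "(s y)\<^sup>2 \<le> progeny_gf (frozen p A) ?s2 y" for y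
    using progeny_gf_square_ge[OF us, of "frozen p A" y] by (simp add: frozen s)
  have "?s2 y \<le> (progeny_gf (frozen p A) ^^ k) ?s2 y" for y
  proof (induction k arbitrary: y)
    case (Suc k)
    have "progeny_gf (frozen p A) ?s2 y \<le> progeny_gf (frozen p A) ((progeny_gf (frozen p A) ^^ k) ?s2) y"
      using Suc by (intro progeny_gf_mono us2 unit_vector_iterate)
    with step[of y] show ?case by simp
  qed simp
  then have square: "(progeny_gf p ^^ n) ?s2 x \<le> measure_pmf.expectation R (mset_prod ?s2)"
    unfolding R[OF us2] by (intro iterate_mono us2 unit_vector_iterate)
  have pointwise: "mset_prod s W \<le> mset_prod (indicat_real (- A)) W + \<eta>
      + (mset_prod t W - mset_prod ?s2 W) / (\<eta> * \<delta>)" for W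
  proof (cases "set_mset W \<inter> A = {}")
    case True
    then have "mset_prod (indicat_real (- A)) W = mset_prod (\<lambda>_. 1) W"
      by (intro arg_cong[where f = prod_mset] image_mset_cong) (auto simp: indicator_def)
    moreover have "mset_prod ?s2 W \<le> mset_prod t W"
      using mset_prod_mono[of W ?s2 t] le by simp
    ultimately show ?thesis
      using mset_prod_le_1[OF us, of W] \<open>\<eta> > 0\<close> \<open>\<delta> > 0\<close>
      by (simp add: add_increasing2)
  next
    case False
    \<comment> \<open>One member in \<open>A\<close> already gives the factor
      \<open>1 + \<delta>\<close>; the remaining members are compared by \<open>le\<close>
      alone.\<close>
    then obtain y V where W: "W = add_mset y V" "y \<in> A" by (metis disjoint_iff mset_add)
    let ?F = "mset_prod s W"
    have V: "0 \<le> mset_prod ?s2 V \<and> mset_prod ?s2 V \<le> mset_prod t V"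
      using le by (intro mset_prod_mono) auto
    have "(1 + \<delta>) * mset_prod ?s2 W = (1 + \<delta>) * (s y)\<^sup>2 * mset_prod ?s2 V"
      by (simp add: W)
    also have "\<dots> \<le> t y * mset_prod t V"
      using V A[OF W(2)] unit_vectorD[OF ut] by (intro mult_mono) auto
    finally have "\<delta> * ?F\<^sup>2 \<le> mset_prod t W - mset_prod ?s2 W"
      by (simp add: W mset_prod_square algebra_simps)
    then have "\<delta> * ?F\<^sup>2 / (\<eta> * \<delta>) \<le> (mset_prod t W - mset_prod ?s2 W) / (\<eta> * \<delta>)"
      using \<open>\<eta> > 0\<close> \<open>\<delta> > 0\<close> by (intro divide_right_mono) auto
    then have "?F\<^sup>2 / \<eta> \<le> (mset_prod t W - mset_prod ?s2 W) / (\<eta> * \<delta>)"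
      using \<open>\<eta> > 0\<close> \<open>\<delta> > 0\<close> by simp
    \<comment> \<open>Truncation at level \<open>\<eta>\<close>: either the product is at most
      \<open>\<eta>\<close>, or its quotient by \<open>\<eta>\<close> exceeds 1 and the second
      moment takes over.\<close>
    moreover have "?F \<le> \<eta> + ?F\<^sup>2 / \<eta>"
    proof (cases "?F \<le> \<eta>")
      case False
      then have "\<eta> * ?F \<le> ?F * ?F" using \<open>\<eta> > 0\<close> by (intro mult_right_mono) auto
      then have "?F \<le> ?F\<^sup>2 / \<eta>" using \<open>\<eta> > 0\<close> by (simp add: field_simps power2_eq_square)
      with \<open>\<eta> > 0\<close> show ?thesis by simp
    qed (use \<open>\<eta> > 0\<close> in \<open>simp add: add_increasing2\<close>)
    ultimately show ?thesis
      using mset_prod_nonneg[OF unit_vector_indicator, of "- A" W] by linarith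
  qed
  note int = integrable_mset_prod[of _ R]
  have "s x = measure_pmf.expectation R (mset_prod s)"
    using s by (simp add: fixed)
  also have "\<dots> \<le> measure_pmf.expectation R (\<lambda>W. mset_prod (indicat_real (- A)) W + \<eta>
      + (mset_prod t W - mset_prod ?s2 W) / (\<eta> * \<delta>))"
    using int[OF us] int[OF ut] int[OF us2] int[OF unit_vector_indicator, of "- A"] pointwise
    by (intro integral_mono) auto
  also have "\<dots> = avoid p A n k x + \<eta> + (t x - measure_pmf.expectation R (mset_prod ?s2)) / (\<eta> * \<delta>)"
    using int[OF us] int[OF ut] int[OF us2] int[OF unit_vector_indicator, of "- A"] fixed[OF t]
      R[OF unit_vector_indicator, of "- A"]
    by (simp add: avoid_def)
  also have "\<dots> \<le> avoid p A n k x + \<eta> + (t x - (progeny_gf p ^^ n) ?s2 x) / (\<eta> * \<delta>)"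
    using square \<open>\<eta> > 0\<close> \<open>\<delta> > 0\<close> by (auto intro!: divide_right_mono)
  finally show ?thesis .
qed

text \<open>Finiteness of \<open>A\<close> turns the pointwise gaps into one uniform
  \<open>\<delta>\<close>; types with \<open>s y = 0\<close> admit any \<open>\<delta>\<close>. Then
  \<open>k\<close> goes to infinity, next \<open>n\<close>, which removes the error term, and
  finally \<open>\<eta>\<close> is arbitrary.\<close>

lemma fixed_point_le_ext_prob:
  fixes p :: "'x::countable \<Rightarrow> 'x multiset pmf"
  assumes s: "s \<in> fixed_points p" and t: "t \<in> fixed_points p"
    and le: "\<And>y. (s y)\<^sup>2 \<le> t y"
    and lim: "\<And>x. (\<lambda>n. (progeny_gf p ^^ n) (\<lambda>y. (s y)\<^sup>2) x) \<longlonglongrightarrow> t x"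
    and "finite A" and A: "\<And>y. y \<in> A \<Longrightarrow> s y = 0 \<or> (s y)\<^sup>2 < t y"
  shows "s x \<le> ext_prob p A x"
proof -
  have "\<exists>\<delta>>0. \<forall>y\<in>A. (1 + \<delta>) * (s y)\<^sup>2 \<le> t y"
    using \<open>finite A\<close> A
  proof (induction A)
    case empty
    show ?case by (intro exI[of _ 1]) simp
  next
    case (insert a A)
    then obtain \<delta> where \<delta>: "\<delta> > 0" "\<And>y. y \<in> A \<Longrightarrow> (1 + \<delta>) * (s y)\<^sup>2 \<le> t y" by blast
    obtain \<epsilon> where \<epsilon>: "\<epsilon> > 0" "(1 + \<epsilon>) * (s a)\<^sup>2 \<le> t a"
    proof (cases "s a = 0")
      case True
      with le[of a] that[of 1] show thesis by simp
    next
      case False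
      then show thesis
        using insert.prems[of a] that[of "t a / (s a)\<^sup>2 - 1"] by (simp add: field_simps)
    qed
    have *: "(1 + min \<delta> \<epsilon>) * c \<le> (1 + \<delta>) * c" "(1 + min \<delta> \<epsilon>) * c \<le> (1 + \<epsilon>) * c" if "c \<ge> 0" for c
      using that by (auto intro!: mult_right_mono)
    show ?case
      using \<delta> \<epsilon> *[OF zero_le_power2] by (intro exI[of _ "min \<delta> \<epsilon>"]) (auto intro: order_trans)
  qed
  then obtain \<delta> where \<delta>: "\<delta> > 0" "\<And>y. y \<in> A \<Longrightarrow> (1 + \<delta>) * (s y)\<^sup>2 \<le> t y" by blast
  obtain L where L: "\<And>n x. (\<lambda>k. avoid p A n k x) \<longlonglongrightarrow> L n x"
      "\<And>x. (\<lambda>n. L n x) \<longlonglongrightarrow> ext_prob p A x"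
    by (rule ext_prob_limit_exists[of p A]) blast
  show ?thesis
  proof (rule field_le_epsilon)
    fix \<eta> :: real assume "\<eta> > 0"
    let ?r = "\<lambda>n. (t x - (progeny_gf p ^^ n) (\<lambda>y. (s y)\<^sup>2) x) / (\<eta> * \<delta>)"
    have "s x \<le> L n x + \<eta> + ?r n" for n
    proof (rule LIMSEQ_le_const)
      show "(\<lambda>k. avoid p A n k x + \<eta> + ?r n) \<longlonglongrightarrow> L n x + \<eta> + ?r n"
        by (intro tendsto_intros L)
      show "\<exists>N. \<forall>k\<ge>N. s x \<le> avoid p A n k x + \<eta> + ?r n"
        using fixed_point_le_avoid[OF s t le \<delta> \<open>\<eta> > 0\<close>] by simp
    qed
    moreover have "(\<lambda>n. L n x + \<eta> + ?r n) \<longlonglongrightarrow> ext_prob p A x + \<eta> + (t x - t x) / (\<eta> * \<delta>)"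
      using \<open>\<eta> > 0\<close> \<delta>(1) by (intro tendsto_intros L lim) simp
    ultimately have "s x \<le> ext_prob p A x + \<eta> + (t x - t x) / (\<eta> * \<delta>)"
      by (intro LIMSEQ_le_const) auto
    then show "s x \<le> ext_prob p A x + \<eta>" by simp
  qed
qed

section \<open>Types where the second moment equals the square\<close>

lemma progeny_gf_eq_0_iff:
  assumes "unit_vector f"
  shows "progeny_gf p f x = 0 \<longleftrightarrow> (\<forall>j\<in>set_pmf (p x). \<exists>y\<in>#j. f y = 0)"
proof -
  have "progeny_gf p f x = 0 \<longleftrightarrow> (AE j in p x. mset_prod f j = 0)"
    unfolding progeny_gf_eq_expectation[OF assms]
    by (intro integral_nonneg_eq_0_iff_AE integrable_mset_prod assms) (simp add: mset_prod_nonneg assms)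
  also have "\<dots> \<longleftrightarrow> (\<forall>j\<in>set_pmf (p x). \<exists>y\<in>#j. f y = 0)"
    by (simp add: AE_measure_pmf_iff prod_mset_zero_iff) (auto simp: image_iff)
  finally show ?thesis .
qed

text \<open>The equality at \<open>x\<close> collapses the chain from \<open>(s x)\<^sup>2\<close>
  through the generating function at the square of \<open>s\<close> to \<open>t x\<close>. The first
  collapse is zero variance, making the product constant; the second equates the products of
  \<open>t\<close> and of the square of \<open>s\<close>, and positivity passes the equality to
  every child.\<close>

lemma deterministic_step:
  assumes s: "s \<in> fixed_points p" and t: "t \<in> fixed_points p" and le: "\<And>y. (s y)\<^sup>2 \<le> t y"
    and x: "0 < s x" "t x = (s x)\<^sup>2" and j: "j \<in> set_pmf (p x)"
  shows "mset_prod s j = s x" and "y \<in># j \<Longrightarrow> 0 < s y \<and> t y = (s y)\<^sup>2"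
proof -
  have us: "unit_vector s" and ut: "unit_vector t"
    and fs: "progeny_gf p s x = s x" and ft: "progeny_gf p t x = t x"
    using s t by (auto simp: fixed_points_iff)
  note us2 = unit_vector_square[OF us]
  have "progeny_gf p (\<lambda>y. (s y)\<^sup>2) x \<le> progeny_gf p t x"
    using us2 ut le by (rule progeny_gf_mono)
  then have eq: "progeny_gf p (\<lambda>y. (s y)\<^sup>2) x = (s x)\<^sup>2"
    using progeny_gf_square_ge[OF us, of p x] x by (simp add: fs ft)
  have int: "integrable (measure_pmf (p x)) (\<lambda>j. (mset_prod s j - s x)\<^sup>2)"
    using unit_vectorD[OF us, of x] mset_prod_nonneg[OF us] mset_prod_le_1[OF us]
    by (intro measure_pmf.integrable_const_bound[where B = 1])
       (auto simp: abs_square_le_1 abs_le_iff intro!: AE_I2, smt+)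
  have "measure_pmf.expectation (p x) (\<lambda>j. (mset_prod s j - s x)\<^sup>2) = 0"
    using progeny_gf_square_diff[OF us, of p x] eq by (simp add: fs)
  from integral_pmf_eq_0_imp[OF int _ this j] show s_eq: "mset_prod s j = s x" by simp
  let ?d = "\<lambda>j. mset_prod t j - mset_prod (\<lambda>y. (s y)\<^sup>2) j"
  have int_d: "integrable (measure_pmf (p x)) ?d"
    using integrable_mset_prod[OF ut] integrable_mset_prod[OF us2] by simp
  have "measure_pmf.expectation (p x) ?d = 0"
    using integrable_mset_prod[OF ut, of "p x"] integrable_mset_prod[OF us2, of "p x"] eq x(2) ft
    by (simp add: progeny_gf_eq_expectation us2 ut)
  from integral_pmf_eq_0_imp[OF int_d _ this j]
  have t_eq: "mset_prod (\<lambda>y. (s y)\<^sup>2) j = mset_prod t j"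
    using mset_prod_mono[of _ "\<lambda>y. (s y)\<^sup>2" t] le by simp
  assume y: "y \<in># j"
  have "(s y)\<^sup>2 = t y"
    using t_eq
  proof (rule mset_prod_eq_imp_eq[rotated])
    show "0 < mset_prod (\<lambda>y. (s y)\<^sup>2) j" using x by (simp add: mset_prod_square s_eq)
  qed (use y le in auto)
  moreover have "0 < s y" using mset_prod_le_member[OF us y] s_eq x by simp
  ultimately show "0 < s y \<and> t y = (s y)\<^sup>2" by simp
qed

lemma mset_prod_le_power:
  assumes "unit_vector f" "\<And>y. y \<in># j \<Longrightarrow> P y \<Longrightarrow> f y \<le> c" "0 \<le> c"
  shows "mset_prod f j \<le> c ^ size (filter_mset P j)"
  using assms(2)
proof (induction j)
  case (add y j)
  then have IH: "mset_prod f j \<le> c ^ size (filter_mset P j)" by simp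
  show ?case
  proof (cases "P y")
    case True
    then have "f y \<le> c" using add.prems by simp
    then show ?thesis
      using True IH mset_prod_nonneg[OF assms(1), of j] assms(3) by (simp add: mult_mono)
  next
    case False
    have "f y * mset_prod f j \<le> mset_prod f j"
      using unit_vectorD[OF assms(1), of y] mset_prod_nonneg[OF assms(1), of j]
      by (simp add: mult_left_le_one_le)
    with False IH show ?thesis by simp
  qed
qed simp

lemma leads_to_offspring:
  fixes p :: "'x::countable \<Rightarrow> 'x multiset pmf"
  shows "j \<in> set_pmf (p x) \<Longrightarrow> y \<in># j \<Longrightarrow> leads_to p x y"
  unfolding leads_to_eq by blast

lemma leads_to_refl: "leads_to p x x"
  by (simp add: leads_to_def)

lemma leads_to_trans: "leads_to p x y \<Longrightarrow> leads_to p y z \<Longrightarrow> leads_to p x z"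
  unfolding leads_to_def by simp

lemma communicates_sym: "communicates p x y \<Longrightarrow> communicates p y x"
  by (simp add: communicates_def)

lemma communicates_trans: "communicates p x y \<Longrightarrow> communicates p y z \<Longrightarrow> communicates p x z"
  unfolding communicates_def by (blast intro: leads_to_trans)

text \<open>A child's value is at least the product over all siblings, which is the parent's value;
  so \<open>s\<close> cannot decrease along a path.\<close>

lemma deterministic_descendant:
  fixes p :: "'x::countable \<Rightarrow> 'x multiset pmf"
  assumes s: "s \<in> fixed_points p" and t: "t \<in> fixed_points p" and le: "\<And>y. (s y)\<^sup>2 \<le> t y"
    and x: "0 < s x" "t x = (s x)\<^sup>2" and "leads_to p x y"
  shows "0 < s y \<and> t y = (s y)\<^sup>2 \<and> s x \<le> s y"
  using assms(6) unfolding leads_to_eq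
proof (induction rule: rtranclp_induct)
  case (step y z)
  then obtain j where j: "j \<in> set_pmf (p y)" "z \<in># j" by blast
  have us: "unit_vector s" using s by (simp add: fixed_points_iff)
  from step.IH have "mset_prod s j = s y" "0 < s z \<and> t z = (s z)\<^sup>2"
    using deterministic_step[OF s t le _ _ j(1)] j(2) by auto
  then show ?case using mset_prod_le_member[OF us j(2)] step.IH by simp
qed (use x in simp)

text \<open>Monotonicity along paths in both directions makes \<open>s\<close> constant on the
  class. Two children in the class would push the product down to \<open>(s x)\<^sup>2\<close>,
  below its required value \<open>s x\<close>. Non-singularity says that the number of class
  children is not almost surely 1, so it is 0 for some offspring.\<close>

lemma deterministic_class:
  fixes p :: "'x::countable \<Rightarrow> 'x multiset pmf"
  assumes s: "s \<in> fixed_points p" and t: "t \<in> fixed_points p" and le: "\<And>y. (s y)\<^sup>2 \<le> t y"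
    and x: "0 < s x" "t x = (s x)\<^sup>2" "s x < 1"
  shows "communicates p y x \<Longrightarrow> s y = s x"
    and "communicates p y x \<Longrightarrow> j \<in> set_pmf (p y) \<Longrightarrow>
      size (filter_mset (\<lambda>w. communicates p w x) j) \<le> 1"
    and "nonsingular_process p \<Longrightarrow> \<exists>y j. communicates p y x \<and> j \<in> set_pmf (p y) \<and>
      (\<forall>w\<in>#j. \<not> communicates p w x)"
proof -
  have us: "unit_vector s" using s by (simp add: fixed_points_iff)
  note desc = deterministic_descendant[OF s t le]
  show const: "s y = s x" if "communicates p y x" for y
    using that desc[of x y] desc[of y x] x by (auto simp: communicates_def)
  show one: "size (filter_mset (\<lambda>w. communicates p w x) j) \<le> 1"
    if y: "communicates p y x" and j: "j \<in> set_pmf (p y)" for y j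
  proof (rule ccontr)
    assume "\<not> size (filter_mset (\<lambda>w. communicates p w x) j) \<le> 1"
    then have "s x ^ size (filter_mset (\<lambda>w. communicates p w x) j) \<le> (s x)\<^sup>2"
      using x by (intro power_decreasing) auto
    moreover have "mset_prod s j \<le> s x ^ size (filter_mset (\<lambda>w. communicates p w x) j)"
      using const x us by (intro mset_prod_le_power) auto
    moreover have "mset_prod s j = s x"
      using deterministic_step(1)[OF s t le _ _ j] desc[of x y] x y const[OF y]
      by (auto simp: communicates_def)
    moreover have "(s x)\<^sup>2 < s x"
      using x by (simp add: power2_eq_square)
    ultimately show False by linarith
  qed
  assume "nonsingular_process p"
  then obtain y where y: "communicates p y x"
      "measure_pmf.prob (p y) {j. size (filter_mset (\<lambda>w. communicates p w y) j) = 1} < 1"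
    unfolding nonsingular_process_def
      prob_first_generation[of p "\<lambda>j. size (filter_mset (\<lambda>w. communicates p w y) j) = 1" y for y]
    by blast
  have same: "communicates p w y \<longleftrightarrow> communicates p w x" for w
    using y(1) by (blast intro: communicates_trans communicates_sym)
  obtain j where j: "j \<in> set_pmf (p y)" "size (filter_mset (\<lambda>w. communicates p w x) j) \<noteq> 1"
  proof (rule ccontr)
    assume "\<not> thesis"
    then have "AE j in p y. size (filter_mset (\<lambda>w. communicates p w y) j) = 1"
      using that unfolding same AE_measure_pmf_iff by blast
    then have "measure_pmf.prob (p y) {j. size (filter_mset (\<lambda>w. communicates p w y) j) = 1} = 1"
      by (subst measure_pmf.prob_eq_1) auto
    with y(2) show False by simp
  qed
  with one[OF y(1) j(1)] have "filter_mset (\<lambda>w. communicates p w x) j = {#}"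
    by (simp add: le_less)
  then have "\<forall>w\<in>#j. \<not> communicates p w x" by (metis count_filter_mset count_empty count_eq_zero_iff)
  with y(1) j(1) show "\<exists>y j. communicates p y x \<and> j \<in> set_pmf (p y) \<and>
      (\<forall>w\<in>#j. \<not> communicates p w x)" by blast
qed

text \<open>If extinction in \<open>{x}\<close> had probability zero from \<open>x\<close>, each
  birth would have to contain a child with value zero, which lies in the class. As there is at most
  one class child, zero spreads along every path within the class and reaches \<open>y\<close>,
  where the birth without class members contradicts it.\<close>

lemma class_extinction_pos:
  fixes p :: "'x::countable \<Rightarrow> 'x multiset pmf"
  assumes one: "\<And>y j. communicates p y x \<Longrightarrow> j \<in> set_pmf (p y) \<Longrightarrow>
      size (filter_mset (\<lambda>w. communicates p w x) j) \<le> 1"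
    and y: "communicates p y x" and j: "j \<in> set_pmf (p y)" "\<forall>w\<in>#j. \<not> communicates p w x"
  shows "ext_prob p {x} x \<noteq> 0"
proof
  assume zero: "ext_prob p {x} x = 0"
  have u: "unit_vector (ext_prob p {x})" "progeny_gf p (ext_prob p {x}) = ext_prob p {x}"
    using ext_prob_fixed_point[of p "{x}"] by (auto simp: fixed_points_iff)
  have zero_child: "\<exists>z\<in>#j. ext_prob p {x} z = 0 \<and> communicates p z x"
    if a: "communicates p a x" "ext_prob p {x} a = 0" and j: "j \<in> set_pmf (p a)" for a j
  proof -
    obtain z where z: "z \<in># j" "ext_prob p {x} z = 0"
      using progeny_gf_eq_0_iff[OF u(1), of p a] a j u(2) by auto
    \<comment> \<open>The types that cannot reach \<open>x\<close> are closed under births and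
      exclude \<open>x\<close>, so their extinction probability in \<open>{x}\<close> is 1, not
      0.\<close>
    have "leads_to p z x"
    proof (rule ccontr)
      assume "\<not> leads_to p z x"
      then have "ext_prob p {x} z = 1"
        by (intro ext_prob_eq_1_on_closed[where B = "{v. \<not> leads_to p v x}"])
           (auto simp: leads_to_refl dest: leads_to_offspring leads_to_trans)
      with z(2) show False by simp
    qed
    with z a leads_to_offspring[of j p a z, OF j z(1)] show ?thesis
      by (auto simp: communicates_def intro: leads_to_trans)
  qed
  have "leads_to p b x \<longrightarrow> ext_prob p {x} b = 0" if "leads_to p x b" for b
    using that unfolding leads_to_eq
  proof (induction rule: rtranclp_induct)
    case (step b c)
    show ?case unfolding leads_to_eq[symmetric]
    proof
      assume c: "leads_to p c x"
      obtain j where j: "j \<in> set_pmf (p b)" "c \<in># j" using step by blast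
      have xb: "leads_to p x b" using step.hyps(1) by (simp add: leads_to_eq)
      have bc: "leads_to p b c" using j by (rule leads_to_offspring)
      have b: "communicates p b x" and c: "communicates p c x"
        using xb bc c by (auto simp: communicates_def intro: leads_to_trans)
      with step.IH have "ext_prob p {x} b = 0"
        by (simp add: leads_to_eq communicates_def)
      from zero_child[OF b this j(1)]
      obtain z where z: "z \<in># j" "ext_prob p {x} z = 0" "communicates p z x" by blast
      \<comment> \<open>The child with value zero and the next type on the path both lie in the
        class, which has room for only one of them.\<close>
      have "z = c"
      proof (rule ccontr)
        assume "z \<noteq> c"
        then have "{#z, c#} \<subseteq># filter_mset (\<lambda>w. communicates p w x) j"
          using z j c by (intro mset_subset_eqI) (auto simp: Suc_le_eq)
        from size_mset_mono[OF this] one[OF b j(1)] show False by simp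
      qed
      with z show "ext_prob p {x} c = 0" by simp
    qed
  qed (use zero in simp)
  with y have "ext_prob p {x} y = 0" by (simp add: communicates_def)
  from zero_child[OF y this j(1)] j(2) show False by blast
qed

text \<open>A type of this kind always has a child of the same kind: its children satisfy the same
  equality, and if all had value 1, or there were none, the product would be 1. So such a lineage
  never dies.\<close>

lemma deterministic_global_ext_prob:
  fixes p :: "'x::countable \<Rightarrow> 'x multiset pmf"
  assumes s: "s \<in> fixed_points p" and t: "t \<in> fixed_points p" and le: "\<And>y. (s y)\<^sup>2 \<le> t y"
    and x: "0 < s x" "t x = (s x)\<^sup>2" "s x < 1"
  shows "global_ext_prob p x = 0"
proof -
  \<comment> \<open>Zero on the types just described and one elsewhere; the persistence of the
    lineage makes it a supersolution.\<close>
  define z where "z = indicat_real (- {v. 0 < s v \<and> t v = (s v)\<^sup>2 \<and> s v < 1})"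
  have uz: "unit_vector z" by (simp add: z_def unit_vector_indicator)
  have z_iff: "z v = 0 \<longleftrightarrow> 0 < s v \<and> t v = (s v)\<^sup>2 \<and> s v < 1" for v
    by (auto simp: z_def indicator_def)
  have us: "unit_vector s" using s by (simp add: fixed_points_iff)
  have "progeny_gf p z v \<le> z v" for v
  proof (cases "z v = 0")
    case True
    then have v: "0 < s v" "t v = (s v)\<^sup>2" "s v < 1" by (auto simp: z_iff)
    have "\<exists>y\<in>#j. z y = 0" if j: "j \<in> set_pmf (p v)" for j
    proof (rule ccontr)
      assume *: "\<not> (\<exists>y\<in>#j. z y = 0)"
      have "s y = 1" if "y \<in># j" for y
        using * that deterministic_step(2)[OF s t le v(1,2) j that] unit_vectorD[OF us, of y]
        by (auto simp: z_iff le_less)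
      then have "mset_prod s j = 1" by (simp cong: image_mset_cong)
      with deterministic_step(1)[OF s t le v(1,2) j] v show False by simp
    qed
    then have "progeny_gf p z v = 0" by (simp add: progeny_gf_eq_0_iff[OF uz])
    with True show ?thesis by simp
  next
    case False
    then have "z v = 1" by (auto simp: z_def indicator_def split: if_splits)
    with unit_vectorD[OF unit_vector_progeny_gf[OF uz]] show ?thesis by simp
  qed
  from global_ext_prob_le[OF uz this, of x] have "global_ext_prob p x \<le> 0"
    using x by (simp add: z_iff[THEN iffD2])
  moreover have "0 \<le> global_ext_prob p x"
    by (simp add: global_ext_prob_def ext_prob_def)
  ultimately show ?thesis by simp
qed

section \<open>Identification of the fixed points\<close>

lemma fixed_point_eq_global_ext_prob:
  fixes p :: "'x::countable \<Rightarrow> 'x multiset pmf"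
  assumes "nonsingular_process p" and s: "s \<in> fixed_points p"
    and eq: "ext_prob p {x} x = global_ext_prob p x" and "s x \<noteq> 1"
  shows "s x = global_ext_prob p x"
proof -
  have us: "unit_vector s" "progeny_gf p s = s" using s by (auto simp: fixed_points_iff)
  obtain t where t: "t \<in> fixed_points p" "\<And>x. (s x)\<^sup>2 \<le> t x"
    "\<And>x. (\<lambda>n. (progeny_gf p ^^ n) (\<lambda>y. (s y)\<^sup>2) x) \<longlonglongrightarrow> t x"
    using second_moment_exists[OF s] by blast
  \<comment> \<open>Otherwise extinction in \<open>{x}\<close> would have positive probability while
    global extinction has probability zero, contradicting \<open>eq\<close>.\<close>
  have "s x = 0 \<or> (s x)\<^sup>2 < t x"
  proof (rule ccontr)
    assume "\<not> (s x = 0 \<or> (s x)\<^sup>2 < t x)"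
    then have x: "0 < s x" "t x = (s x)\<^sup>2" "s x < 1"
      using t(2)[of x] unit_vectorD[OF us(1), of x] \<open>s x \<noteq> 1\<close> by auto
    note props = deterministic_class[OF s t(1,2) x]
    obtain y j where "communicates p y x" "j \<in> set_pmf (p y)" "\<forall>w\<in>#j. \<not> communicates p w x"
      using props(3)[OF assms(1)] by blast
    from class_extinction_pos[OF _ this] props(2) have "ext_prob p {x} x \<noteq> 0" by blast
    with eq deterministic_global_ext_prob[OF s t(1,2) x] show False by simp
  qed
  \<comment> \<open>With the singleton \<open>{x}\<close> as \<open>A\<close>, the value
    \<open>s x\<close> is squeezed between two quantities that \<open>eq\<close> identifies.\<close>
  then have "s x \<le> ext_prob p {x} x"
    by (intro fixed_point_le_ext_prob[OF s t]) auto
  moreover have "global_ext_prob p x \<le> s x"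
    using us by (intro global_ext_prob_le) auto
  ultimately show ?thesis using eq by simp
qed

lemma ext_vectors_eq_fixed_points:
  fixes p :: "'x::countable \<Rightarrow> 'x multiset pmf"
  assumes "nonsingular_process p" and eq: "\<And>x. ext_prob p {x} x = global_ext_prob p x"
  shows "ext_vectors p = fixed_points p"
proof
  show "ext_vectors p \<subseteq> fixed_points p"
    unfolding ext_vectors_def using ext_prob_fixed_point by blast
  show "fixed_points p \<subseteq> ext_vectors p"
  proof
    fix s assume s: "s \<in> fixed_points p"
    then have us: "unit_vector s" "progeny_gf p s = s" by (auto simp: fixed_points_iff)
    \<comment> \<open>On this set the extinction probability is squeezed between those for
      \<open>UNIV\<close> and for a singleton. Off it, the value 1 of \<open>s\<close> is inherited
      by all children, so the set is never reached.\<close>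
    define A where "A = {x. s x \<noteq> 1}"
    have "ext_prob p A x = s x" for x
    proof (cases "x \<in> A")
      case True
      then have "s x = global_ext_prob p x"
        using fixed_point_eq_global_ext_prob[OF assms(1) s eq] by (simp add: A_def)
      moreover have "ext_prob p A x \<le> ext_prob p {x} x" "global_ext_prob p x \<le> ext_prob p A x"
        using True by (auto simp: global_ext_prob_def intro!: ext_prob_antimono)
      ultimately show ?thesis using eq[of x] by simp
    next
      case False
      have "ext_prob p A x = 1"
      proof (rule ext_prob_eq_1_on_closed)
        fix v j assume v: "v \<in> {x. s x = 1}" and j: "j \<in> set_pmf (p v)"
        have "mset_prod s j = 1"
          using v j progeny_gf_eq_1_iff[OF us(1), of p v] us(2) by simp
        then have "s y = 1" if "y \<in># j" for y
          using mset_prod_le_member[OF us(1) that] unit_vectorD[OF us(1), of y] by simp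
        then show "set_mset j \<subseteq> {x. s x = 1}" by blast
      qed (use False in \<open>auto simp: A_def\<close>)
      with False show ?thesis by (simp add: A_def)
    qed
    then have "s = ext_prob p A" by auto
    then show "s \<in> ext_vectors p" by (simp add: ext_vectors_def)
  qed
qed

text \<open>The value 1 is inherited by descendants, so in a single class \<open>s\<close> is below
  1 everywhere. Once the deterministic case is excluded, the bound by extinction probabilities holds
  for every finite set of types, and the finite sets exhaust the typeset.\<close>

lemma irreducible_fixed_point_le:
  fixes p :: "'x::countable \<Rightarrow> 'x multiset pmf"
  assumes "nonsingular_process p" and irr: "irreducible_process p"
    and s: "s \<in> fixed_points p" and "s \<noteq> (\<lambda>x. 1)"
  shows "s x \<le> partial_ext_prob p x"
proof -
  have us: "unit_vector s" "progeny_gf p s = s" using s by (auto simp: fixed_points_iff)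
  have comm: "communicates p a b" for a b
    using irr by (simp add: irreducible_process_def)
  have lt: "s y < 1" for y
  proof (rule ccontr)
    assume "\<not> s y < 1"
    then have y: "s y = 1" using unit_vectorD[OF us(1), of y] by simp
    have "s z = 1" if "leads_to p y z" for z
      using that unfolding leads_to_eq
    proof (induction rule: rtranclp_induct)
      case (step b c)
      then obtain j where j: "j \<in> set_pmf (p b)" "c \<in># j" by blast
      then have "mset_prod s j = 1"
        using step.IH progeny_gf_eq_1_iff[OF us(1), of p b] us(2) by simp
      then show ?case
        using mset_prod_le_member[OF us(1) j(2)] unit_vectorD[OF us(1), of c] by simp
    qed (rule y)
    with comm \<open>s \<noteq> (\<lambda>x. 1)\<close> show False by (auto simp: communicates_def)
  qed
  obtain t where t: "t \<in> fixed_points p" "\<And>x. (s x)\<^sup>2 \<le> t x"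
    "\<And>x. (\<lambda>n. (progeny_gf p ^^ n) (\<lambda>y. (s y)\<^sup>2) x) \<longlonglongrightarrow> t x"
    using second_moment_exists[OF s] by blast
  have "s y = 0 \<or> (s y)\<^sup>2 < t y" for y
  proof (rule ccontr)
    assume "\<not> (s y = 0 \<or> (s y)\<^sup>2 < t y)"
    then have y: "0 < s y" "t y = (s y)\<^sup>2"
      using t(2)[of y] unit_vectorD[OF us(1), of y] by auto
    note props = deterministic_class[OF s t(1,2) y lt]
    from props(3)[OF assms(1)] obtain w j
      where "j \<in> set_pmf (p w)" "\<forall>w\<in>#j. \<not> communicates p w y" by blast
    \<comment> \<open>All types communicate, so an offspring multiset without class members is
      empty. Its product is 1, which would have to equal \<open>s w\<close>.\<close>
    with comm have "{#} \<in> set_pmf (p w)" by (metis multiset_nonemptyE)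
    moreover have "0 < s w \<and> t w = (s w)\<^sup>2"
      using deterministic_descendant[OF s t(1,2) y, of w] comm by (simp add: communicates_def)
    ultimately have "s w = 1"
      using deterministic_step(1)[OF s t(1,2), of w "{#}"] by simp
    with lt[of w] show False by simp
  qed
  moreover have "finite {y::'x. to_nat y \<le> n}" for n
    using finite_vimageI[OF finite_atMost[of n] inj_to_nat] by (simp add: vimage_def)
  ultimately have "s x \<le> ext_prob p {y. to_nat y \<le> n} x" for n
    by (intro fixed_point_le_ext_prob[OF s t]) auto
  with tendsto_partial_ext_prob[of p x] show ?thesis
    by (intro LIMSEQ_le_const) auto
qed

theorem corollary1:
  fixes p :: "'x::countable \<Rightarrow> 'x multiset pmf" and s :: "'x \<Rightarrow> real"
  assumes "nonsingular_process p" and "s \<in> fixed_points p"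
  shows "((\<forall>x. ext_prob p {x} x = global_ext_prob p x) \<longrightarrow>
            (\<forall>x. s x = 1 \<or> s x = ext_prob p {x} x) \<and> ext_vectors p = fixed_points p)
       \<and> (irreducible_process p \<and> s \<noteq> (\<lambda>x. 1) \<longrightarrow> (\<forall>x. s x \<le> partial_ext_prob p x))
       \<and> (irreducible_process p \<and> partial_ext_prob p = global_ext_prob p \<longrightarrow>
            fixed_points p = {global_ext_prob p, (\<lambda>x. 1)})"
proof (intro conjI impI)
  assume "\<forall>x. ext_prob p {x} x = global_ext_prob p x"
  then show "\<forall>x. s x = 1 \<or> s x = ext_prob p {x} x" and "ext_vectors p = fixed_points p"
    using fixed_point_eq_global_ext_prob[OF assms] ext_vectors_eq_fixed_points[OF assms(1)] by auto
next
  assume "irreducible_process p \<and> s \<noteq> (\<lambda>x. 1)"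
  then show "\<forall>x. s x \<le> partial_ext_prob p x"
    using irreducible_fixed_point_le[OF assms(1) _ assms(2)] by blast
next
  assume *: "irreducible_process p \<and> partial_ext_prob p = global_ext_prob p"
  show "fixed_points p = {global_ext_prob p, (\<lambda>x. 1)}"
  proof
    show "fixed_points p \<subseteq> {global_ext_prob p, (\<lambda>x. 1)}"
    proof
      fix r assume r: "r \<in> fixed_points p"
      have "r = global_ext_prob p" if "r \<noteq> (\<lambda>x. 1)"
      proof
        fix x
        have "r x \<le> global_ext_prob p x"
          using irreducible_fixed_point_le[OF assms(1) _ r that] * by metis
        moreover have "global_ext_prob p x \<le> r x"
          using r by (intro global_ext_prob_le) (auto simp: fixed_points_iff)
        ultimately show "r x = global_ext_prob p x" by simp
      qed
      then show "r \<in> {global_ext_prob p, (\<lambda>x. 1)}" by blast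
    qed
    have u1: "unit_vector (\<lambda>x. 1)" by (simp add: unit_vector_def)
    then have "(\<lambda>x. 1) \<in> fixed_points p"
      by (auto simp: fixed_points_iff progeny_gf_eq_1_iff)
    then show "{global_ext_prob p, (\<lambda>x. 1)} \<subseteq> fixed_points p"
      using ext_prob_fixed_point[of p UNIV] by (simp add: global_ext_prob_def)
  qed
qed

end
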